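(* Let $\Gamma=(V,E)$ be a finite multigraph, and let $s,n$ be positive integers with $2s\le n$. Define $h^0,h^1:Z_{s,n}(\Gamma)\to\mathbb{N}$ by $h^0(\mathcal{F})=\dim H^0(\Gamma,\mathcal{F})$ and $h^1(\mathcal{F})=\dim H^1(\Gamma,\mathcal{F})$. Then $h^0$ and $h^1$ are upper semi-continuous with respect to the Zariski topology on $Z_{s,n}(\Gamma)$.
   Context: Let $\mathbb{V}$ be a real vector space of dimension $n$. $Z_{s,n}(\Gamma)$ is the set of $((S_v)_{v\in V},(\alpha_e)_{e\in E})\in\mathrm{Gr}(s,\mathbb{V})^{|V|}\times(\mathbb{V}^* )^E$ with $\alpha_e(S_v)=0$ whenever $v\in e$ and $S_u\cap S_v=\{0\}$ for all distinct $u,v$; it carries the Zariski topology induced from the real algebraic variety $\mathrm{Gr}(s,\mathbb{V})^{|V|}\times(\mathbb{V}^* )^E$, where $\mathrm{Gr}(s,\mathbb{R}^n)$ is realised as orthogonal projections $P$ with $P=P^t$, $P^2=P$, $\mathrm{Tr}P=s$. Each point gives a sheaf $\mathcal{F}$ on $\Gamma$ with $\mathcal{F}(v)=\mathbb{V}/S_v$, $\mathcal{F}(e)=\mathbb{V}/\ker\alpha_e$ and reduction maps as restrictions. $H^0=\ker d$, $H^1=\operatorname{coker}d$ for the signed coboundary $d(w)_e=\sum_{v\in e}[v:e]r^v_e(w_v)$, $[v:e]=-[u:e]$ for $e=vu$. Upper semi-continuous: preimages of $(-\infty,a)$ are open.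
   Formalization: Upper semi-continuity of h^1 is proved only on the part of Z_{s,n}(Γ) where every α_e is nonzero; on all of Z it fails, e.g. for two parallel edges with covectors (α, cα), where h^1 is 1 for c≠0 but 0 for c=0. The h^0 claim is proved on all of Z. *)

theory Defs
  imports "HOL-Analysis.Analysis" "HOL-Algebra.AbelCoset" "Jordan_Normal_Form.Missing_VectorSpace"
begin

section \<open>Quotients and products of real vector spaces\<close>

text \<open>Vector spaces with an explicit carrier are module records over the field of real numbers;
  the ring multiplication and unit of a module record carry no meaning.  Dimensions are
  \<^const>\<open>vectorspace.dim\<close>.\<close>

definition real_field :: "real ring" where
  "real_field = \<lparr>carrier = UNIV, mult = (*), one = 1, zero = 0, add = (+)\<rparr>"

definition euclid :: "(real, real ^ 'n) module" where
  "euclid = \<lparr>carrier = UNIV, mult = (\<lambda>x y. 0), one = 0, zero = 0, add = (+), smult = (*\<^sub>R)\<rparr>"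

definition quotient_module :: "('r, 'a) module \<Rightarrow> 'a set \<Rightarrow> ('r, 'a set) module" where
  "quotient_module M H =
     \<lparr>carrier = a_rcosets\<^bsub>M\<^esub> H, mult = (\<lambda>A B. H), one = H, zero = H, add = set_add M,
      smult = (\<lambda>c A. \<Union>x\<in>A. H +>\<^bsub>M\<^esub> (c \<odot>\<^bsub>M\<^esub> x))\<rparr>"

definition product_module :: "'i set \<Rightarrow> ('i \<Rightarrow> ('r, 'a) module) \<Rightarrow> ('r, 'i \<Rightarrow> 'a) module" where
  "product_module I M =
     \<lparr>carrier = (\<Pi>\<^sub>E i\<in>I. carrier (M i)),
      mult = (\<lambda>x y. \<lambda>i\<in>I. \<zero>\<^bsub>M i\<^esub>), one = (\<lambda>i\<in>I. \<zero>\<^bsub>M i\<^esub>), zero = (\<lambda>i\<in>I. \<zero>\<^bsub>M i\<^esub>),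
      add = (\<lambda>x y. \<lambda>i\<in>I. x i \<oplus>\<^bsub>M i\<^esub> y i), smult = (\<lambda>c x. \<lambda>i\<in>I. c \<odot>\<^bsub>M i\<^esub> x i)\<rparr>"


section \<open>Multigraphs and sheaf cohomology\<close>

record ('v, 'e) multigraph =
  verts :: "'v set"
  edges :: "'e set"
  ends :: "'e \<Rightarrow> 'v set"

text \<open>Parallel edges and loops (edges with a single end) are allowed.\<close>

definition finite_multigraph :: "('v, 'e) multigraph \<Rightarrow> bool" where
  "finite_multigraph \<Gamma> \<longleftrightarrow> finite (verts \<Gamma>) \<and> finite (edges \<Gamma>) \<and>
     (\<forall>e\<in>edges \<Gamma>. ends \<Gamma> e \<subseteq> verts \<Gamma> \<and> card (ends \<Gamma> e) \<in> {1, 2})"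

text \<open>\<open>\<sigma> v e\<close> is the incidence number \<open>[v:e]\<close>.  At a loop the first condition, with \<open>u = v\<close>,
  forces the value 0: the contributions of the two half-edges cancel.\<close>

definition signed_incidence :: "('v, 'e) multigraph \<Rightarrow> ('v \<Rightarrow> 'e \<Rightarrow> real) \<Rightarrow> bool" where
  "signed_incidence \<Gamma> \<sigma> \<longleftrightarrow> (\<forall>e\<in>edges \<Gamma>. \<forall>u v. ends \<Gamma> e = {u, v} \<longrightarrow>
     \<sigma> v e = - \<sigma> u e \<and> (u \<noteq> v \<longrightarrow> \<sigma> v e \<in> {1, -1}))"

record ('v, 'e, 'a, 'b) sheaf =
  vertex_stalk :: "'v \<Rightarrow> (real, 'a) module"
  edge_stalk :: "'e \<Rightarrow> (real, 'b) module"
  restriction :: "'v \<Rightarrow> 'e \<Rightarrow> 'a \<Rightarrow> 'b"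

definition cochains0 ::
  "('v, 'e) multigraph \<Rightarrow> ('v, 'e, 'a, 'b) sheaf \<Rightarrow> (real, 'v \<Rightarrow> 'a) module" where
  "cochains0 \<Gamma> \<F> = product_module (verts \<Gamma>) (vertex_stalk \<F>)"

definition cochains1 ::
  "('v, 'e) multigraph \<Rightarrow> ('v, 'e, 'a, 'b) sheaf \<Rightarrow> (real, 'e \<Rightarrow> 'b) module" where
  "cochains1 \<Gamma> \<F> = product_module (edges \<Gamma>) (edge_stalk \<F>)"

definition coboundary ::
  "('v, 'e) multigraph \<Rightarrow> ('v \<Rightarrow> 'e \<Rightarrow> real) \<Rightarrow> ('v, 'e, 'a, 'b) sheaf \<Rightarrow> ('v \<Rightarrow> 'a) \<Rightarrow> ('e \<Rightarrow> 'b)"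
where
  "coboundary \<Gamma> \<sigma> \<F> w = (\<lambda>e\<in>edges \<Gamma>. \<Oplus>\<^bsub>edge_stalk \<F> e\<^esub> v\<in>ends \<Gamma> e.
     \<sigma> v e \<odot>\<^bsub>edge_stalk \<F> e\<^esub> restriction \<F> v e (w v))"

definition H0 ::
  "('v, 'e) multigraph \<Rightarrow> ('v \<Rightarrow> 'e \<Rightarrow> real) \<Rightarrow> ('v, 'e, 'a, 'b) sheaf \<Rightarrow> (real, 'v \<Rightarrow> 'a) module"
where
  "H0 \<Gamma> \<sigma> \<F> = cochains0 \<Gamma> \<F>
     \<lparr>carrier := a_kernel (cochains0 \<Gamma> \<F>) (cochains1 \<Gamma> \<F>) (coboundary \<Gamma> \<sigma> \<F>)\<rparr>"

definition H1 ::
  "('v, 'e) multigraph \<Rightarrow> ('v \<Rightarrow> 'e \<Rightarrow> real) \<Rightarrow> ('v, 'e, 'a, 'b) sheaf \<Rightarrow> (real, ('e \<Rightarrow> 'b) set) module"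
where
  "H1 \<Gamma> \<sigma> \<F> = quotient_module (cochains1 \<Gamma> \<F>) (coboundary \<Gamma> \<sigma> \<F> ` carrier (cochains0 \<Gamma> \<F>))"


section \<open>The configuration variety\<close>

text \<open>Points of \<open>Gr(s, \<real>\<^sup>n)\<close> are orthogonal projection matrices; the subspace is the range.\<close>

definition grassmannian :: "nat \<Rightarrow> (real ^ 'n ^ 'n) set" where
  "grassmannian s = {P. transpose P = P \<and> P ** P = P \<and> trace P = real s}"

definition subspace_of :: "real ^ 'n ^ 'n \<Rightarrow> (real ^ 'n) set" where
  "subspace_of P = range ((*v) P)"

type_synonym ('v, 'e, 'n) config = "('v \<Rightarrow> real ^ 'n ^ 'n) \<times> ('e \<Rightarrow> real ^ 'n \<Rightarrow> real)"

definition ambient :: "('v, 'e) multigraph \<Rightarrow> nat \<Rightarrow> ('v, 'e, 'n::finite) config set" where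
  "ambient \<Gamma> s = (\<Pi>\<^sub>E v\<in>verts \<Gamma>. grassmannian s) \<times> (\<Pi>\<^sub>E e\<in>edges \<Gamma>. {\<alpha>. linear \<alpha>})"

inductive regular_function :: "('v, 'e) multigraph \<Rightarrow> (('v, 'e, 'n::finite) config \<Rightarrow> real) \<Rightarrow> bool"
  for \<Gamma> where
  const: "regular_function \<Gamma> (\<lambda>p. c)"
| matrix_entry: "v \<in> verts \<Gamma> \<Longrightarrow> regular_function \<Gamma> (\<lambda>p. fst p v $ i $ j)"
| covector_entry: "e \<in> edges \<Gamma> \<Longrightarrow> regular_function \<Gamma> (\<lambda>p. snd p e (axis i 1))"
| add: "regular_function \<Gamma> f \<Longrightarrow> regular_function \<Gamma> g \<Longrightarrow> regular_function \<Gamma> (\<lambda>p. f p + g p)"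
| mult: "regular_function \<Gamma> f \<Longrightarrow> regular_function \<Gamma> g \<Longrightarrow> regular_function \<Gamma> (\<lambda>p. f p * g p)"

definition zariski_closed ::
  "('v, 'e) multigraph \<Rightarrow> nat \<Rightarrow> ('v, 'e, 'n::finite) config set \<Rightarrow> bool" where
  "zariski_closed \<Gamma> s C \<longleftrightarrow>
     (\<exists>F \<subseteq> Collect (regular_function \<Gamma>). C = {p \<in> ambient \<Gamma> s. \<forall>f\<in>F. f p = 0})"

definition zariski_topology ::
  "('v, 'e) multigraph \<Rightarrow> nat \<Rightarrow> ('v, 'e, 'n::finite) config topology" where
  "zariski_topology \<Gamma> s =
     topology (\<lambda>U. U \<subseteq> ambient \<Gamma> s \<and> zariski_closed \<Gamma> s (ambient \<Gamma> s - U))"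

lemma zariski_closed_Un:
  assumes "zariski_closed \<Gamma> s C" "zariski_closed \<Gamma> s D"
  shows "zariski_closed \<Gamma> s (C \<union> D)"
proof -
  obtain F where F: "F \<subseteq> Collect (regular_function \<Gamma>)" "C = {p \<in> ambient \<Gamma> s. \<forall>f\<in>F. f p = 0}"
    using assms(1) unfolding zariski_closed_def by blast
  obtain G where G: "G \<subseteq> Collect (regular_function \<Gamma>)" "D = {p \<in> ambient \<Gamma> s. \<forall>f\<in>G. f p = 0}"
    using assms(2) unfolding zariski_closed_def by blast
  let ?K = "{\<lambda>p. f p * g p | f g. f \<in> F \<and> g \<in> G}"
  have "?K \<subseteq> Collect (regular_function \<Gamma>)"
    using F(1) G(1) by (auto intro: regular_function.mult)
  moreover have "C \<union> D = {p \<in> ambient \<Gamma> s. \<forall>f\<in>?K. f p = 0}" (is "_ = ?Z")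
  proof (intro equalityI subsetI)
    fix p assume p: "p \<in> C \<union> D"
    have "h p = 0" if hK: "h \<in> ?K" for h
    proof -
      obtain f g where fg: "f \<in> F" "g \<in> G" and h: "h = (\<lambda>p. f p * g p)" using hK by blast
      have "f p = 0 \<or> g p = 0" using p fg unfolding F(2) G(2) by blast
      then show ?thesis unfolding h by simp
    qed
    moreover have "p \<in> ambient \<Gamma> s" using p unfolding F(2) G(2) by blast
    ultimately show "p \<in> ?Z" by simp
  next
    fix p assume p: "p \<in> ?Z"
    then have amb: "p \<in> ambient \<Gamma> s" by simp
    show "p \<in> C \<union> D"
    proof (rule ccontr)
      assume "p \<notin> C \<union> D"
      with amb obtain f g where fg: "f \<in> F" "f p \<noteq> 0" "g \<in> G" "g p \<noteq> 0"
        unfolding F(2) G(2) by blast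
      have K: "(\<lambda>p. f p * g p) \<in> ?K" using fg(1,3) by blast
      have "\<forall>f\<in>?K. f p = 0" using p by simp
      from bspec[OF this K] have "f p * g p = 0" .
      with fg(2,4) show False by simp
    qed
  qed
  ultimately show ?thesis unfolding zariski_closed_def by blast
qed

lemma zariski_closed_Inter:
  assumes "\<And>C. C \<in> \<C> \<Longrightarrow> zariski_closed \<Gamma> s C"
  shows "zariski_closed \<Gamma> s (ambient \<Gamma> s \<inter> \<Inter>\<C>)"
proof -
  have "\<forall>C\<in>\<C>. \<exists>F. F \<subseteq> Collect (regular_function \<Gamma>) \<and> C = {p \<in> ambient \<Gamma> s. \<forall>f\<in>F. f p = 0}"
    using assms unfolding zariski_closed_def by blast
  from bchoice[OF this] obtain F where F: "\<forall>C\<in>\<C>. F C \<subseteq> Collect (regular_function \<Gamma>) \<and>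
      C = {p \<in> ambient \<Gamma> s. \<forall>f\<in>F C. f p = 0}" ..
  have mem: "p \<in> C \<longleftrightarrow> p \<in> ambient \<Gamma> s \<and> (\<forall>f\<in>F C. f p = 0)" if "C \<in> \<C>" for C p
  proof -
    have "C = {p \<in> ambient \<Gamma> s. \<forall>f\<in>F C. f p = 0}" using F that by simp
    from arg_cong[OF this, of "\<lambda>A. p \<in> A"] show ?thesis by simp
  qed
  have "(\<Union>C\<in>\<C>. F C) \<subseteq> Collect (regular_function \<Gamma>)" using F by (simp add: UN_least)
  moreover have "ambient \<Gamma> s \<inter> \<Inter>\<C> = {p \<in> ambient \<Gamma> s. \<forall>f\<in>(\<Union>C\<in>\<C>. F C). f p = 0}"
    (is "?A = ?B")
  proof (intro equalityI subsetI)
    fix p assume "p \<in> ?A"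
    then have "p \<in> ambient \<Gamma> s" "\<And>C. C \<in> \<C> \<Longrightarrow> p \<in> C" by auto
    then show "p \<in> ?B" using mem by (intro CollectI conjI ballI) (auto 0 3)
  next
    fix p assume "p \<in> ?B"
    then have p: "p \<in> ambient \<Gamma> s" "\<And>C f. C \<in> \<C> \<Longrightarrow> f \<in> F C \<Longrightarrow> f p = 0" by auto
    have "p \<in> C" if "C \<in> \<C>" for C unfolding mem[OF that] using p that by simp
    with p(1) show "p \<in> ?A" by simp
  qed
  ultimately show ?thesis unfolding zariski_closed_def by blast
qed

lemma openin_zariski_topology:
  "openin (zariski_topology \<Gamma> s) U \<longleftrightarrow> U \<subseteq> ambient \<Gamma> s \<and> zariski_closed \<Gamma> s (ambient \<Gamma> s - U)"
proof -
  let ?L = "\<lambda>U. U \<subseteq> ambient \<Gamma> s \<and> zariski_closed \<Gamma> s (ambient \<Gamma> s - U)"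
  have int: "?L (U \<inter> W)" if "?L U" "?L W" for U W
    using that zariski_closed_Un[of \<Gamma> s "ambient \<Gamma> s - U" "ambient \<Gamma> s - W"]
    by (auto simp: Diff_Int)
  have un: "?L (\<Union>\<U>)" if "\<forall>U\<in>\<U>. ?L U" for \<U>
  proof -
    have "zariski_closed \<Gamma> s (ambient \<Gamma> s \<inter> \<Inter>((-) (ambient \<Gamma> s) ` \<U>))"
      using that by (intro zariski_closed_Inter) auto
    moreover have "ambient \<Gamma> s \<inter> \<Inter>((-) (ambient \<Gamma> s) ` \<U>) = ambient \<Gamma> s - \<Union>\<U>" by blast
    ultimately show ?thesis using that by auto
  qed
  have "istopology ?L"
    unfolding istopology_def by (intro conjI allI impI int un) simp_all
  from fun_cong[OF topology_inverse'[OF this], of U] show ?thesis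
    unfolding zariski_topology_def .
qed

definition config_space :: "('v, 'e) multigraph \<Rightarrow> nat \<Rightarrow> ('v, 'e, 'n::finite) config set" where
  "config_space \<Gamma> s = {(P, \<alpha>) \<in> ambient \<Gamma> s.
     (\<forall>e\<in>edges \<Gamma>. \<forall>v\<in>ends \<Gamma> e. \<forall>x\<in>subspace_of (P v). \<alpha> e x = 0) \<and>
     (\<forall>u\<in>verts \<Gamma>. \<forall>v\<in>verts \<Gamma>. u \<noteq> v \<longrightarrow> subspace_of (P u) \<inter> subspace_of (P v) = {0})}"

definition config_topology ::
  "('v, 'e) multigraph \<Rightarrow> nat \<Rightarrow> ('v, 'e, 'n::finite) config topology" where
  "config_topology \<Gamma> s = subtopology (zariski_topology \<Gamma> s) (config_space \<Gamma> s)"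

text \<open>The configurations in which every \<open>ker \<alpha>\<^sub>e\<close> is a hyperplane, so that every edge stalk is a line.
  On all of \<^const>\<open>config_space\<close> the function \<open>dim H\<^sup>1\<close> need not be upper semicontinuous, because
  \<open>V / ker \<alpha>\<^sub>e\<close> vanishes when \<open>\<alpha>\<^sub>e = 0\<close>: with two parallel edges and covectors \<open>(\<alpha>, c \<alpha>)\<close>, where \<open>\<alpha> \<noteq> 0\<close>,
  it is 1 for \<open>c \<noteq> 0\<close> but 0 for \<open>c = 0\<close>.\<close>

definition nonzero_covectors :: "('v, 'e) multigraph \<Rightarrow> ('v, 'e, 'n::finite) config set" where
  "nonzero_covectors \<Gamma> = {p. \<forall>e\<in>edges \<Gamma>. snd p e \<noteq> (\<lambda>x. 0)}"

definition kernel_of :: "(real ^ 'n \<Rightarrow> real) \<Rightarrow> (real ^ 'n) set" where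
  "kernel_of \<alpha> = {x. \<alpha> x = 0}"

definition config_sheaf ::
  "('v, 'e, 'n::finite) config \<Rightarrow> ('v, 'e, (real ^ 'n) set, (real ^ 'n) set) sheaf" where
  "config_sheaf p =
     \<lparr>vertex_stalk = (\<lambda>v. quotient_module euclid (subspace_of (fst p v))),
      edge_stalk = (\<lambda>e. quotient_module euclid (kernel_of (snd p e))),
      restriction = (\<lambda>v e A. A <+>\<^bsub>euclid\<^esub> kernel_of (snd p e))\<rparr>"

definition h0 ::
  "('v, 'e) multigraph \<Rightarrow> ('v \<Rightarrow> 'e \<Rightarrow> real) \<Rightarrow> ('v, 'e, 'n::finite) config \<Rightarrow> nat" where
  "h0 \<Gamma> \<sigma> p = vectorspace.dim real_field (H0 \<Gamma> \<sigma> (config_sheaf p))"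

definition h1 ::
  "('v, 'e) multigraph \<Rightarrow> ('v \<Rightarrow> 'e \<Rightarrow> real) \<Rightarrow> ('v, 'e, 'n::finite) config \<Rightarrow> nat" where
  "h1 \<Gamma> \<sigma> p = vectorspace.dim real_field (H1 \<Gamma> \<sigma> (config_sheaf p))"

definition upper_semicontinuous :: "'a topology \<Rightarrow> ('a \<Rightarrow> nat) \<Rightarrow> bool" where
  "upper_semicontinuous X f \<longleftrightarrow> (\<forall>a::real. openin X {x \<in> topspace X. real (f x) < a})"

end

theory Submission
  imports Defs
begin

text \<open>By rank-nullity, \<open>h\<^sup>0\<close> plus the rank of the coboundary is the constant \<open>|V| (n - s)\<close>, and where
  no covector vanishes \<open>h\<^sup>1\<close> plus that rank is the constant \<open>|E|\<close>; so it suffices that each set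
  \<open>{rank \<ge> k}\<close> is Zariski open.  Lift a 0-cochain to a family \<open>w\<close> of vectors and identify
  \<open>\<real>\<^sup>n / ker \<alpha>\<^sub>e\<close> with the image of \<open>\<alpha>\<^sub>e\<close>: the coboundary becomes \<open>e \<mapsto> \<Sum>\<^sub>v [v:e] \<alpha>\<^sub>e(w\<^sub>v)\<close>, which
  for fixed \<open>w\<close> is a regular function of the configuration.  The rank is at least \<open>k\<close> iff for some
  \<open>w\<^sub>1, \<dots>, w\<^sub>k\<close> these real vectors are linearly independent, that is, iff one of the regular functions
  ``Gram determinant of \<open>w\<^sub>1, \<dots>, w\<^sub>k\<close>'' does not vanish.\<close>

section \<open>Linear maps between vector spaces with explicit carriers\<close>

lemma real_field_simps [simp]:
  "carrier real_field = UNIV" "x \<otimes>\<^bsub>real_field\<^esub> y = x * y" "\<one>\<^bsub>real_field\<^esub> = 1"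
  "\<zero>\<^bsub>real_field\<^esub> = 0" "x \<oplus>\<^bsub>real_field\<^esub> y = x + y"
  by (simp_all add: real_field_def)

lemma field_real_field: "field real_field"
proof -
  have "abelian_group real_field"
  proof (rule abelian_groupI)
    show "\<exists>y\<in>carrier real_field. y \<oplus>\<^bsub>real_field\<^esub> x = \<zero>\<^bsub>real_field\<^esub>" for x
      by (rule bexI[of _ "- x"]) simp_all
  qed simp_all
  moreover have "Group.comm_monoid real_field"
    by (rule comm_monoidI) simp_all
  ultimately have "cring real_field"
    by (rule cringI) (simp add: distrib_right)
  moreover have "x \<in> Units real_field" if "x \<noteq> 0" for x
    using that unfolding Units_def by (intro CollectI conjI bexI[of _ "inverse x"]) simp_all
  then have "Units real_field = carrier real_field - {\<zero>\<^bsub>real_field\<^esub>}"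
    by (auto simp: Units_def)
  ultimately show ?thesis by (rule cring.cring_fieldI)
qed

lemma linear_mapI:
  assumes "vectorspace K V" "vectorspace K W"
    and "\<And>x. x \<in> carrier V \<Longrightarrow> T x \<in> carrier W"
    and "\<And>x y. x \<in> carrier V \<Longrightarrow> y \<in> carrier V \<Longrightarrow> T (x \<oplus>\<^bsub>V\<^esub> y) = T x \<oplus>\<^bsub>W\<^esub> T y"
    and "\<And>c x. c \<in> carrier K \<Longrightarrow> x \<in> carrier V \<Longrightarrow> T (c \<odot>\<^bsub>V\<^esub> x) = c \<odot>\<^bsub>W\<^esub> T x"
  shows "linear_map K V W T"
  using assms
  by (auto simp: linear_map_def mod_hom_def mod_hom_axioms_def module_hom_def vectorspace_def)

text \<open>Generators of the kernel together with preimages of generators of \<open>W\<close>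
  generate \<open>V\<close>. Rank-nullity presupposes a finite-dimensional domain; this supplies it
  in the induction over products.\<close>

lemma fin_dim_of_exact:
  assumes T: "linear_map K V W T" and surj: "T ` carrier V = carrier W"
    and W: "vectorspace.fin_dim K W"
    and ker: "vectorspace.fin_dim K (V\<lparr>carrier := mod_hom.ker V W T\<rparr>)"
  shows "vectorspace.fin_dim K V"
proof -
  interpret V: vectorspace K V using T by (simp add: linear_map_def)
  interpret W: vectorspace K W using T by (simp add: linear_map_def)
  interpret linear_map K V W T by fact
  interpret Ker: vectorspace K "V.vs ker"
    using kerT_is_subspace V.subspace_is_vs by blast
  obtain A where A: "finite A" "A \<subseteq> ker" "Ker.span A = ker"
    using ker unfolding Ker.fin_dim_def by auto
  obtain B where B: "finite B" "B \<subseteq> carrier W" "W.span B = carrier W"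
    using W unfolding W.fin_dim_def by auto
  obtain C where C: "finite C" "C \<subseteq> carrier V" "B = T ` C"
    using finite_subset_image[OF B(1)] B(2) surj by metis
  have kerV: "ker \<subseteq> carrier V" unfolding ker_def by auto
  have AC: "A \<union> C \<subseteq> carrier V" using A(2) kerV C(2) by auto
  let ?S = "V.span (A \<union> C)"
  have S: "submodule K ?S V" using V.span_is_submodule[OF AC] .
  have SV: "?S \<subseteq> carrier V" using V.span_is_subset2[OF AC] .
  \<comment> \<open>The image of the span is a submodule containing the generators \<open>B\<close>,
    hence all of \<open>W\<close>.\<close>
  have "submodule K (T ` ?S) W"
  proof (unfold_locales)
    show "T ` ?S \<subseteq> carrier W" using SV by auto
    show "v \<oplus>\<^bsub>W\<^esub> w \<in> T ` ?S" if vw: "v \<in> T ` ?S" "w \<in> T ` ?S" for v w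
    proof -
      obtain v' w' where vw: "v' \<in> ?S" "w' \<in> ?S" "v = T v'" "w = T w'" using vw by blast
      moreover from this SV have "v' \<in> carrier V" "w' \<in> carrier V" by auto
      ultimately have "v \<oplus>\<^bsub>W\<^esub> w = T (v' \<oplus>\<^bsub>V\<^esub> w')" by simp
      then show ?thesis using vw submodule.m_closed[OF S] by blast
    qed
    show "\<zero>\<^bsub>W\<^esub> \<in> T ` ?S"
      using submodule.zero_closed[OF S] f0_is_0 by (metis imageI)
    show "c \<odot>\<^bsub>W\<^esub> v \<in> T ` ?S" if c: "c \<in> carrier K" and v: "v \<in> T ` ?S" for c v
    proof -
      obtain v' where v: "v' \<in> ?S" "v = T v'" using v by blast
      then have "c \<odot>\<^bsub>W\<^esub> v = T (c \<odot>\<^bsub>V\<^esub> v')" using SV c by auto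
      then show ?thesis using v submodule.smult_closed[OF S c] by blast
    qed
  qed
  moreover have "B \<subseteq> T ` ?S" using C V.in_own_span[OF AC] by auto
  ultimately have TS: "carrier W \<subseteq> T ` ?S" using W.span_is_subset B(3) by metis
  have kerS: "ker \<subseteq> ?S"
  proof -
    have "V.span A = ker"
      using V.span_li_not_depend(1)[OF A(2) ker_is_submodule] A(3) by simp
    then show ?thesis using V.span_is_monotone[of A "A \<union> C"] by auto
  qed
  have "v \<in> ?S" if v: "v \<in> carrier V" for v
  proof -
    \<comment> \<open>Any \<open>v\<close> differs from an element of the span with the same image
      by a kernel element, which lies in the span as well.\<close>
    obtain u where u: "u \<in> ?S" "T v = T u" using TS v f_im by blast
    have uV: "u \<in> carrier V" using u SV by auto
    have "v \<ominus>\<^bsub>V\<^esub> u \<in> ker" unfolding ker_def using v uV u(2) f_minus[OF v uV] 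
      by (simp add: W.M.minus_other_side)
    then have "(v \<ominus>\<^bsub>V\<^esub> u) \<oplus>\<^bsub>V\<^esub> u \<in> ?S" using kerS u(1) submodule.m_closed[OF S] by blast
    moreover have "(v \<ominus>\<^bsub>V\<^esub> u) \<oplus>\<^bsub>V\<^esub> u = v"
      using v uV by (simp add: V.M.minus_eq V.M.a_assoc V.M.l_neg)
    ultimately show ?thesis by simp
  qed
  then have "?S = carrier V" using SV by auto
  then show ?thesis unfolding V.fin_dim_def using A(1) C(1) AC by blast
qed

section \<open>Quotients\<close>

text \<open>Closure under negation is scaling by -1. This opens the coset calculus of additive
  groups.\<close>

lemma abelian_subgroup_of_subspace:
  assumes V: "vectorspace K M" and H: "VectorSpace.subspace K H M"
  shows "abelian_subgroup H M"
proof -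
  interpret vectorspace K M by fact
  interpret H: submodule K H M using H by (simp add: VectorSpace.subspace_def)
  have "subgroup H (add_monoid M)"
  proof (rule M.add.subgroupI)
    show "\<ominus>\<^bsub>M\<^esub> a \<in> H" if a: "a \<in> H" for a
    proof -
      have "\<ominus>\<^bsub>K\<^esub> \<one>\<^bsub>K\<^esub> \<odot>\<^bsub>M\<^esub> a \<in> H" using a by (intro H.smult_closed) auto
      then show ?thesis using a H.subset smult_minus_1[of a] by (metis subsetD)
    qed
    show "H \<noteq> {}" using H.zero_closed by blast
  qed (use H.subset in auto)
  then show ?thesis
    by (intro abelian_subgroupI3 additive_subgroup.intro M.abelian_group_axioms)
qed

text \<open>The coset map is onto and respects the operations, so the axioms are inherited from
  \<open>M\<close>. The point to check is that scalar multiplication, defined as a union over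
  representatives, yields a single coset.\<close>

lemma
  assumes V: "vectorspace K M" and H: "VectorSpace.subspace K H M"
  shows vectorspace_quotient: "vectorspace K (quotient_module M H)"
    and linear_map_quotient: "linear_map K M (quotient_module M H) (\<lambda>x. H +>\<^bsub>M\<^esub> x)"
proof -
  interpret vectorspace K M by fact
  interpret H: submodule K H M using H by (simp add: VectorSpace.subspace_def)
  let ?Q = "quotient_module M H"
  let ?q = "\<lambda>x. H +>\<^bsub>M\<^esub> x"
  interpret A: abelian_subgroup H M using abelian_subgroup_of_subspace[OF V H] .
  have carr: "carrier ?Q = ?q ` carrier M"
    by (auto simp: quotient_module_def A_RCOSETS_def')
  have add: "?q x \<oplus>\<^bsub>?Q\<^esub> ?q y = ?q (x \<oplus>\<^bsub>M\<^esub> y)" if "x \<in> carrier M" "y \<in> carrier M" for x y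
    using that by (simp add: quotient_module_def A.a_rcos_sum)
  have smult: "c \<odot>\<^bsub>?Q\<^esub> ?q x = ?q (c \<odot>\<^bsub>M\<^esub> x)" if c: "c \<in> carrier K" and x: "x \<in> carrier M" for c x
  proof -
    \<comment> \<open>Two representatives differ by some \<open>h\<close> in \<open>H\<close>, and
      their multiples by \<open>c\<close> times \<open>h\<close>, again in \<open>H\<close>; so all
      members of the union below coincide.\<close>
    have const: "?q (c \<odot>\<^bsub>M\<^esub> y) = ?q (c \<odot>\<^bsub>M\<^esub> x)" if y: "y \<in> ?q x" for y
    proof -
      obtain h where h: "h \<in> H" "y = h \<oplus>\<^bsub>M\<^esub> x" using y by (auto simp: a_r_coset_def')
      then have "c \<odot>\<^bsub>M\<^esub> y = c \<odot>\<^bsub>M\<^esub> h \<oplus>\<^bsub>M\<^esub> c \<odot>\<^bsub>M\<^esub> x"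
        using c x H.subset smult_r_distr by auto
      then have "c \<odot>\<^bsub>M\<^esub> y \<in> ?q (c \<odot>\<^bsub>M\<^esub> x)" using h c by (auto simp: a_r_coset_def')
      then show ?thesis using c x M.a_repr_independence[OF _ _ A.a_subgroup] by (metis smult_closed)
    qed
    have "c \<odot>\<^bsub>?Q\<^esub> ?q x = (\<Union>y\<in>?q x. ?q (c \<odot>\<^bsub>M\<^esub> y))"
      by (simp add: quotient_module_def)
    also have "\<dots> = (\<Union>y\<in>?q x. ?q (c \<odot>\<^bsub>M\<^esub> x))" by (rule SUP_cong[OF refl const])
    also have "\<dots> = ?q (c \<odot>\<^bsub>M\<^esub> x)" using A.a_rcos_self[OF x] by blast
    finally show ?thesis .
  qed
  have zero: "\<zero>\<^bsub>?Q\<^esub> = ?q \<zero>\<^bsub>M\<^esub>"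
    using H.subset by (simp add: quotient_module_def)
  show vs: "vectorspace K ?Q"
  proof (rule vs_criteria)
    show "field K" by unfold_locales
    show "\<forall>v\<in>carrier ?Q. \<exists>w\<in>carrier ?Q. v \<oplus>\<^bsub>?Q\<^esub> w = \<zero>\<^bsub>?Q\<^esub>"
    proof
      fix v assume "v \<in> carrier ?Q"
      then obtain x where "x \<in> carrier M" "v = ?q x" by (auto simp: carr)
      then show "\<exists>w\<in>carrier ?Q. v \<oplus>\<^bsub>?Q\<^esub> w = \<zero>\<^bsub>?Q\<^esub>"
        by (intro bexI[of _ "?q (\<ominus>\<^bsub>M\<^esub> x)"]) (auto simp: add zero M.r_neg carr)
    qed
  qed (auto simp: carr add smult zero M.a_ac smult_assoc1 smult_l_distr smult_r_distr)
  show "linear_map K M ?Q ?q"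
    by (rule linear_mapI[OF V vs]) (auto simp: carr add smult)
qed

text \<open>The coset map is onto with kernel \<open>H\<close>, so this is rank-nullity.\<close>

lemma
  assumes V: "vectorspace K M" and H: "VectorSpace.subspace K H M"
    and fd: "vectorspace.fin_dim K M"
  shows fin_dim_quotient: "vectorspace.fin_dim K (quotient_module M H)"
    and dim_quotient: "vectorspace.dim K (quotient_module M H) + vectorspace.dim K (M\<lparr>carrier := H\<rparr>)
      = vectorspace.dim K M"
proof -
  let ?Q = "quotient_module M H"
  interpret vectorspace K M by fact
  interpret H: submodule K H M using H by (simp add: VectorSpace.subspace_def)
  interpret q: linear_map K M ?Q "\<lambda>x. H +>\<^bsub>M\<^esub> x"
    using linear_map_quotient[OF V H] .
  interpret A: abelian_subgroup H M using abelian_subgroup_of_subspace[OF V H] .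
  have surj: "(\<lambda>x. H +>\<^bsub>M\<^esub> x) ` carrier M = carrier ?Q"
    by (auto simp: quotient_module_def A_RCOSETS_def')
  have ker: "q.ker = H"
  proof -
    have "H +>\<^bsub>M\<^esub> x = H \<longleftrightarrow> x \<in> H" if "x \<in> carrier M" for x
      using that A.a_rcos_self A.a_rcos_const by metis
    then show ?thesis using H.subset unfolding q.ker_def by (auto simp: quotient_module_def)
  qed
  show "vectorspace.fin_dim K ?Q" using q.surj_fin_dim[OF fd surj] .
  have "q.im = carrier ?Q" using surj by (simp add: q.im_def)
  then show "vectorspace.dim K ?Q + vectorspace.dim K (M\<lparr>carrier := H\<rparr>) = vectorspace.dim K M"
    using q.rank_nullity[OF fd] by (simp add: ker)
qed

section \<open>Products\<close>

lemma vectorspace_product: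
  assumes K: "field K" and M: "\<And>i. i \<in> I \<Longrightarrow> vectorspace K (M i)"
  shows "vectorspace K (product_module I M)"
proof -
  have m: "module K (M i)" if "i \<in> I" for i using M[OF that] by (simp add: vectorspace_def)
  have g: "abelian_group (M i)" if "i \<in> I" for i using m[OF that] by (simp add: module_def)
  note [simp] = abelian_monoid.a_closed[OF abelian_group.axioms(1)[OF g]]
    abelian_monoid.zero_closed[OF abelian_group.axioms(1)[OF g]]
    module.smult_closed[OF m] abelian_group.a_inv_closed[OF g]
  show ?thesis
  proof (rule vs_criteria[OF K])
    show "\<forall>v\<in>carrier (product_module I M). \<exists>w\<in>carrier (product_module I M).
        v \<oplus>\<^bsub>product_module I M\<^esub> w = \<zero>\<^bsub>product_module I M\<^esub>"
    proof
      fix v assume v: "v \<in> carrier (product_module I M)"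
      have "(\<lambda>i\<in>I. v i \<oplus>\<^bsub>M i\<^esub> \<ominus>\<^bsub>M i\<^esub> v i) = (\<lambda>i\<in>I. \<zero>\<^bsub>M i\<^esub>)"
        using v by (intro restrict_ext abelian_group.r_neg[OF g]) (auto simp: product_module_def)
      then show "\<exists>w\<in>carrier (product_module I M). v \<oplus>\<^bsub>product_module I M\<^esub> w = \<zero>\<^bsub>product_module I M\<^esub>"
        using v by (intro bexI[of _ "\<lambda>i\<in>I. \<ominus>\<^bsub>M i\<^esub> v i"]) (auto simp: product_module_def PiE_iff cong: restrict_cong)
    qed
  qed (auto simp: product_module_def PiE_iff fun_eq_iff extensional_def
        module.smult_assoc1[OF m] module.smult_l_distr[OF m] module.smult_r_distr[OF m] module.smult_one[OF m]
        abelian_monoid.a_assoc[OF abelian_group.axioms(1)[OF g]]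
        abelian_monoid.r_zero[OF abelian_group.axioms(1)[OF g]]
        intro!: abelian_monoid.a_comm[OF abelian_group.axioms(1)[OF g]])
qed

text \<open>Induction on the index set: projection to the new coordinate is onto \<open>M i\<close>,
  and its kernel is a copy of the product over the old indices, so rank-nullity adds one
  summand.\<close>

lemma
  assumes "finite I" and K: "field K" and "\<And>i. i \<in> I \<Longrightarrow> vectorspace K (M i)"
    and "\<And>i. i \<in> I \<Longrightarrow> vectorspace.fin_dim K (M i)"
  shows fin_dim_product: "vectorspace.fin_dim K (product_module I M)"
    and dim_product: "vectorspace.dim K (product_module I M) = (\<Sum>i\<in>I. vectorspace.dim K (M i))"
proof -
  have "vectorspace.fin_dim K (product_module I M) \<and>
    vectorspace.dim K (product_module I M) = (\<Sum>i\<in>I. vectorspace.dim K (M i))"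
    using assms(1,3,4)
  proof (induction I)
    case empty
    interpret P: vectorspace K "product_module {} M" using vectorspace_product[OF K, of "{}" M] by simp
    \<comment> \<open>The empty product contains only the everywhere undefined function, which is
      its zero, so the empty set is a basis.\<close>
    have c: "carrier (product_module {} M) = {\<zero>\<^bsub>product_module {} M\<^esub>}"
      by (auto simp: product_module_def)
    have "P.gen_set {}" using c P.span_empty by simp
    then have "P.basis {}" using P.finite_lin_indpt2[of "{}"] by (auto simp: P.basis_def)
    then show ?case using P.dim_basis[of "{}"] by (auto simp: P.fin_dim_def P.basis_def)
  next
    case (insert i I)
    let ?P = "product_module I M" and ?U = "product_module (insert i I) M"
    interpret P: vectorspace K ?P using insert vectorspace_product[OF K, of I M] by simp
    interpret U: vectorspace K ?U using insert vectorspace_product[OF K, of "insert i I" M] by simp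
    interpret Mi: vectorspace K "M i" using insert by simp
    have mod: "module K (M j)" if "j \<in> I" for j using insert that by (simp add: vectorspace_def)
    interpret T: linear_map K ?U "M i" "\<lambda>x. x i"
    proof (rule linear_mapI)
      show "vectorspace K ?U" "vectorspace K (M i)" by unfold_locales
    qed (auto simp: product_module_def)
    have surj: "(\<lambda>x. x i) ` carrier ?U = carrier (M i)"
    proof
      show "carrier (M i) \<subseteq> (\<lambda>x. x i) ` carrier ?U"
      proof
        fix y assume "y \<in> carrier (M i)"
        moreover have "\<zero>\<^bsub>M j\<^esub> \<in> carrier (M j)" if "j \<in> I" for j
          using mod[OF that] by (simp add: module_def abelian_group_def abelian_monoid.zero_closed)
        ultimately have "(\<lambda>j\<in>insert i I. if j = i then y else \<zero>\<^bsub>M j\<^esub>) \<in> carrier ?U"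
          by (auto simp: product_module_def)
        then show "y \<in> (\<lambda>x. x i) ` carrier ?U" by (rule rev_image_eqI) simp
      qed
    qed auto
    let ?ker = "U.vs T.ker"
    interpret ker: vectorspace K ?ker
      using T.kerT_is_subspace U.subspace_is_vs by blast
    have ker: "T.ker = {x \<in> \<Pi>\<^sub>E j\<in>insert i I. carrier (M j). x i = \<zero>\<^bsub>M i\<^esub>}"
      unfolding T.ker_def by (simp add: product_module_def)
    \<comment> \<open>Extension by zero in coordinate \<open>i\<close> identifies the product over
      \<open>I\<close> with the kernel; restriction to \<open>I\<close> inverts it.\<close>
    let ?j = "\<lambda>x. \<lambda>j\<in>insert i I. if j = i then \<zero>\<^bsub>M i\<^esub> else x j"
    interpret j: linear_map K ?P ?ker ?j
    proof (rule linear_mapI)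
      show "vectorspace K ?P" "vectorspace K ?ker" by unfold_locales
    qed (use insert.hyps in \<open>auto simp: ker, auto simp: product_module_def PiE_iff fun_eq_iff\<close>)
    have inj: "inj_on ?j (carrier ?P)"
    proof (rule inj_onI)
      fix x y assume xy: "x \<in> carrier ?P" "y \<in> carrier ?P" and eq: "?j x = ?j y"
      have "x k = y k" if "k \<in> I" for k
        using fun_cong[OF eq, of k] that insert.hyps by (auto split: if_splits)
      then show "x = y" using xy by (auto simp: product_module_def intro: PiE_ext)
    qed
    have sj: "?j ` carrier ?P = carrier ?ker"
    proof
      show "carrier ?ker \<subseteq> ?j ` carrier ?P"
      proof
        fix x assume "x \<in> carrier ?ker"
        then have x: "x \<in> (\<Pi>\<^sub>E j\<in>insert i I. carrier (M j))" "x i = \<zero>\<^bsub>M i\<^esub>"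
          by (simp_all add: ker)
        have "x = ?j (restrict x I)"
        proof
          fix k show "x k = ?j (restrict x I) k"
            using x PiE_arb[OF x(1), of k] by auto
        qed
        moreover have "restrict x I \<in> carrier ?P"
          using PiE_mem[OF x(1)] by (simp add: product_module_def)
        ultimately show "x \<in> ?j ` carrier ?P" by (rule image_eqI)
      qed
    qed (use j.f_im in blast)
    have fdP: "P.fin_dim" and dimP: "P.dim = (\<Sum>i\<in>I. vectorspace.dim K (M i))"
      and fdM: "Mi.fin_dim" using insert.IH insert.prems by blast+
    have fdker: "ker.fin_dim" using j.surj_fin_dim[OF fdP sj] .
    have "P.dim = ker.dim" using j.dim_eq[OF fdP inj sj] .
    moreover have fdU: "U.fin_dim" using fin_dim_of_exact[OF T.linear_map_axioms surj fdM fdker] .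
    moreover have "T.im = carrier (M i)" using surj by (simp add: T.im_def)
    ultimately show ?case using T.rank_nullity[OF fdU] dimP insert.hyps by simp
  qed
  then show "vectorspace.fin_dim K (product_module I M)"
    "vectorspace.dim K (product_module I M) = (\<Sum>i\<in>I. vectorspace.dim K (M i))" by auto
qed

section \<open>Subspaces of Euclidean space\<close>

lemma euclid_simps [simp]:
  "carrier euclid = UNIV" "\<zero>\<^bsub>euclid\<^esub> = 0" "x \<oplus>\<^bsub>euclid\<^esub> y = x + y" "c \<odot>\<^bsub>euclid\<^esub> x = c *\<^sub>R x"
  by (simp_all add: euclid_def)

lemma vectorspace_euclid: "vectorspace real_field euclid"
proof (rule vs_criteria[OF field_real_field])
  show "\<forall>v\<in>carrier euclid. \<exists>w\<in>carrier euclid. v \<oplus>\<^bsub>euclid\<^esub> w = \<zero>\<^bsub>euclid\<^esub>"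
    by (auto intro: exI[of _ "- _"])
qed (simp_all add: scaleR_add_left scaleR_add_right add.commute)

lemma subspace_euclid:
  assumes "real_vector.subspace S"
  shows "VectorSpace.subspace real_field S euclid"
proof (intro VectorSpace.subspace.intro vectorspace_euclid)
  interpret vectorspace real_field euclid by (rule vectorspace_euclid)
  show "submodule real_field S euclid"
    using assms by unfold_locales
      (simp_all add: subspace_add subspace_scale subspace_0)
qed

text \<open>Linear combinations in the record are ordinary finite sums, so a basis for
  \<open>real_vector\<close> is also a basis in the carrier sense. Dimension facts about Euclidean
  space thereby transfer to stalks.\<close>

lemma
  fixes S :: "(real ^ 'n) set"
  assumes S: "real_vector.subspace S"
  shows fin_dim_euclid_subspace: "vectorspace.fin_dim real_field (euclid\<lparr>carrier := S\<rparr>)"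
    and dim_euclid_subspace: "vectorspace.dim real_field (euclid\<lparr>carrier := S\<rparr>) = real_vector.dim S"
proof -
  let ?E = "euclid\<lparr>carrier := S\<rparr> :: (real, real ^ 'n) module"
  interpret E: vectorspace real_field ?E
    using vectorspace.subspace_is_vs[OF vectorspace_euclid subspace_euclid[OF S]] .
  obtain B where B: "B \<subseteq> S" "independent B" "S \<subseteq> real_vector.span B" "card B = real_vector.dim S"
    using basis_exists[of S] by blast
  have fin: "finite B" using B(2) finiteI_independent by blast
  have lincomb: "E.lincomb a A = (\<Sum>v\<in>A. a v *\<^sub>R v)" if "finite A" "A \<subseteq> S" for a A
    using that
  proof (induction A)
    case (insert v A)
    have "(\<lambda>v. a v *\<^sub>R v) \<in> A \<rightarrow> carrier ?E" "a v *\<^sub>R v \<in> carrier ?E"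
      using insert.prems S by (auto simp: subspace_scale)
    then show ?case using insert by (simp add: E.lincomb_def)
  qed (simp add: E.lincomb_def)
  have "E.lin_indpt B"
  proof (rule E.finite_lin_indpt2[OF fin])
    show "B \<subseteq> carrier ?E" using B(1) by simp
    fix a assume "E.lincomb a B = \<zero>\<^bsub>?E\<^esub>"
    then have "(\<Sum>v\<in>B. a v *\<^sub>R v) = 0" using lincomb[OF fin B(1)] by simp
    then show "\<forall>v\<in>B. a v = \<zero>\<^bsub>real_field\<^esub>"
      using B(2) fin unfolding independent_explicit by auto
  qed
  moreover have "E.span B = S"
  proof -
    have "E.span B = {E.lincomb a B | a. a \<in> B \<rightarrow> carrier real_field}"
      using E.finite_span[OF fin] B(1) by simp
    also have "\<dots> = range (\<lambda>a. \<Sum>v\<in>B. a v *\<^sub>R v)"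
      by (auto simp: lincomb[OF fin B(1)])
    also have "\<dots> = S"
      using span_finite[OF fin] span_minimal[OF B(1) S] B(3) by auto
    finally show ?thesis .
  qed
  ultimately have "E.basis B" using B(1) by (simp add: E.basis_def)
  then show "E.fin_dim" "E.dim = real_vector.dim S"
    using E.dim_basis[OF fin] fin B(4) by (auto simp: E.basis_def E.fin_dim_def)
qed

lemma
  fin_dim_euclid: "vectorspace.fin_dim real_field (euclid :: (real, real ^ 'n::finite) module)" and
  dim_euclid: "vectorspace.dim real_field (euclid :: (real, real ^ 'n::finite) module) = CARD('n)"
proof -
  have eq: "euclid\<lparr>carrier := UNIV\<rparr> = (euclid :: (real, real ^ 'n) module)" by (simp add: euclid_def)
  show "vectorspace.fin_dim real_field (euclid :: (real, real ^ 'n::finite) module)"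
    using fin_dim_euclid_subspace[OF subspace_UNIV, where 'n = 'n] unfolding eq .
  show "vectorspace.dim real_field (euclid :: (real, real ^ 'n::finite) module) = CARD('n)"
    using dim_euclid_subspace[OF subspace_UNIV, where 'n = 'n] unfolding eq by simp
qed

text \<open>For an orthonormal basis \<open>B\<close> of the range, the trace is the sum over i of
  <e_i, P e_i>, hence the sum over i and b of (b_i)^2, hence the sum of the squared norms in
  \<open>B\<close>, which is \<open>card B\<close>. This turns the trace condition of
  \<open>grassmannian\<close> into a dimension.\<close>

lemma dim_range_projection:
  fixes P :: "real ^ 'n ^ 'n"
  assumes sym: "transpose P = P" and idem: "P ** P = P"
  shows "real (real_vector.dim (range ((*v) P))) = trace P"
proof -
  have sub: "real_vector.subspace (range ((*v) P))"
    by (intro linear_subspace_image subspace_UNIV) simp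
  obtain B where B: "B \<subseteq> range ((*v) P)" "pairwise orthogonal B" "\<And>b. b \<in> B \<Longrightarrow> norm b = 1"
    "independent B" "card B = real_vector.dim (range ((*v) P))" "real_vector.span B = range ((*v) P)"
    using orthonormal_basis_subspace[OF sub] by metis
  have fin: "finite B" using B(4) finiteI_independent by blast
  have fixB: "P *v b = b" if "b \<in> B" for b
    using that B(1) idem by (auto simp: matrix_vector_mul_assoc)
  have "trace P = (\<Sum>i\<in>UNIV. axis i 1 \<bullet> (P *v axis i 1))"
    by (simp add: trace_def inner_axis' matrix_vector_mul_component inner_axis)
  also have "\<dots> = (\<Sum>i\<in>UNIV. \<Sum>b\<in>B. (b $ i)\<^sup>2)"
  proof (rule sum.cong[OF refl])
    fix i :: 'n
    have "P *v axis i 1 = (\<Sum>b\<in>B. ((P *v axis i 1) \<bullet> b) *\<^sub>R b)"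
      using orthonormal_basis_expand[OF B(2,3) _ fin, of "P *v axis i 1"] B(6) by simp
    then have "axis i 1 \<bullet> (P *v axis i 1) = axis i 1 \<bullet> (\<Sum>b\<in>B. ((P *v axis i 1) \<bullet> b) *\<^sub>R b)"
      by simp
    also have "\<dots> = (\<Sum>b\<in>B. ((P *v axis i 1) \<bullet> b) * (b $ i))"
      by (simp add: inner_sum_right inner_axis')
    also have "\<dots> = (\<Sum>b\<in>B. (b $ i)\<^sup>2)"
    proof (rule sum.cong[OF refl])
      fix b assume b: "b \<in> B"
      \<comment> \<open>\<open>P\<close> is symmetric, so it can be moved to \<open>b\<close>, which
        it fixes as an element of its range.\<close>
      have "(P *v axis i 1) \<bullet> b = axis i 1 \<bullet> (P *v b)"
        using dot_lmul_matrix[of "axis i 1" P b] transpose_matrix_vector[of P "axis i 1"] sym by simp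
      then show "((P *v axis i 1) \<bullet> b) * (b $ i) = (b $ i)\<^sup>2"
        using fixB[OF b] by (simp add: inner_axis' power2_eq_square)
    qed
    finally show "axis i 1 \<bullet> (P *v axis i 1) = (\<Sum>b\<in>B. (b $ i)\<^sup>2)" .
  qed
  also have "\<dots> = (\<Sum>b\<in>B. \<Sum>i\<in>UNIV. (b $ i)\<^sup>2)" by (rule sum.swap)
  also have "\<dots> = (\<Sum>b\<in>B. b \<bullet> b)" by (simp add: inner_vec_def power2_eq_square)
  also have "\<dots> = real (card B)" using B(3) by (simp add: dot_square_norm)
  finally show ?thesis using B(5) by simp
qed

section \<open>The subspaces and kernels of a configuration\<close>

lemma subspace_subspace_of: "real_vector.subspace (subspace_of P)"
  unfolding subspace_of_def by (intro linear_subspace_image subspace_UNIV) simp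

lemma dim_subspace_of:
  assumes "P \<in> grassmannian s"
  shows "real_vector.dim (subspace_of P) = s"
  using assms dim_range_projection[of P] by (simp add: grassmannian_def subspace_of_def)

lemma subspace_kernel_of:
  assumes "linear \<alpha>"
  shows "real_vector.subspace (kernel_of \<alpha>)"
  unfolding kernel_of_def using assms by (rule linear_subspace_kernel)

lemma dim_kernel_of:
  fixes \<alpha> :: "real ^ 'n \<Rightarrow> real"
  assumes \<alpha>: "linear \<alpha>" and nz: "\<alpha> \<noteq> (\<lambda>x. 0)"
  shows "real_vector.dim (kernel_of \<alpha>) = CARD('n) - 1"
proof -
  \<comment> \<open>\<open>adjoint \<alpha> 1\<close> is the vector representing \<alpha> as an
    inner product, so the kernel is the hyperplane orthogonal to it.\<close>
  have eq: "\<alpha> x = adjoint \<alpha> 1 \<bullet> x" for x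
    using adjoint_works[OF \<alpha>, of x 1] by (simp add: inner_commute)
  then have "adjoint \<alpha> 1 \<noteq> 0" using nz by auto
  from dim_hyperplane[OF this] show ?thesis by (simp add: kernel_of_def eq)
qed

section \<open>Cosets\<close>

text \<open>The laws for the operations are linearity of the coset map. Later arguments compute with
  representatives and need not open the quotient record.\<close>

lemma
  fixes S :: "(real ^ 'n) set"
  assumes S: "real_vector.subspace S"
  shows coset_add: "(S +>\<^bsub>euclid\<^esub> x) \<oplus>\<^bsub>quotient_module euclid S\<^esub> (S +>\<^bsub>euclid\<^esub> y) = S +>\<^bsub>euclid\<^esub> (x + y)"
    and coset_smult: "c \<odot>\<^bsub>quotient_module euclid S\<^esub> (S +>\<^bsub>euclid\<^esub> x) = S +>\<^bsub>euclid\<^esub> (c *\<^sub>R x)"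
    and coset_zero: "\<zero>\<^bsub>quotient_module euclid S\<^esub> = S +>\<^bsub>euclid\<^esub> 0"
    and carrier_cosets: "carrier (quotient_module euclid S) = range (\<lambda>x. S +>\<^bsub>euclid\<^esub> x)"
    and coset_eq_iff: "S +>\<^bsub>euclid\<^esub> x = S +>\<^bsub>euclid\<^esub> y \<longleftrightarrow> x - y \<in> S"
    and coset_sum: "finite A \<Longrightarrow>
      finsum (quotient_module euclid S) (\<lambda>a. S +>\<^bsub>euclid\<^esub> g a) A = S +>\<^bsub>euclid\<^esub> (\<Sum>a\<in>A. g a)"
proof -
  let ?Q = "quotient_module euclid S"
  let ?q = "\<lambda>x. S +>\<^bsub>euclid\<^esub> x"
  interpret q: linear_map real_field euclid ?Q ?q
    by (rule linear_map_quotient[OF vectorspace_euclid subspace_euclid[OF S]])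
  interpret Q: vectorspace real_field ?Q
    by (rule vectorspace_quotient[OF vectorspace_euclid subspace_euclid[OF S]])
  show add: "?q x \<oplus>\<^bsub>?Q\<^esub> ?q y = ?q (x + y)" for x y using q.f_add[of x y] by simp
  show "c \<odot>\<^bsub>?Q\<^esub> ?q x = ?q (c *\<^sub>R x)" using q.f_smult[of c x] by simp
  show zero: "\<zero>\<^bsub>?Q\<^esub> = ?q 0" using q.f0_is_0 by simp
  show carr: "carrier ?Q = range ?q" by (auto simp: quotient_module_def A_RCOSETS_def')
  have mem: "z \<in> ?q x \<longleftrightarrow> z - x \<in> S" for z x
  proof -
    have "?q x = (\<lambda>h. h + x) ` S" by (auto simp: a_r_coset_def')
    then show ?thesis by (auto intro: image_eqI[of _ _ "z - x"])
  qed
  show "?q x = ?q y \<longleftrightarrow> x - y \<in> S"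
  proof
    assume "?q x = ?q y"
    then show "x - y \<in> S" using mem[of x x] mem[of x y] subspace_0[OF S] by simp
  next
    assume xy: "x - y \<in> S"
    have "z - x \<in> S \<longleftrightarrow> z - y \<in> S" for z
      using subspace_add[OF S _ xy, of "z - x"] subspace_diff[OF S _ xy, of "z - y"] by auto
    then show "?q x = ?q y" using mem by blast
  qed
  show "finsum ?Q (\<lambda>a. ?q (g a)) A = ?q (\<Sum>a\<in>A. g a)" if "finite A"
    using that
  proof (induction A)
    case (insert a A)
    have "(\<lambda>a. ?q (g a)) \<in> A \<rightarrow> carrier ?Q" "?q (g a) \<in> carrier ?Q" by (auto simp: carr)
    then show ?case using insert by (simp add: add)
  qed (simp add: zero)
qed

text \<open>Since S + T = T, adding the larger subspace setwise is the reduction map and keeps the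
  representative. The restrictions of \<open>config_sheaf\<close> are of this form.\<close>

lemma coset_absorb:
  fixes S T :: "(real ^ 'n) set"
  assumes S: "real_vector.subspace S" and T: "real_vector.subspace T" and ST: "S \<subseteq> T"
  shows "(S +>\<^bsub>euclid\<^esub> x) <+>\<^bsub>euclid\<^esub> T = T +>\<^bsub>euclid\<^esub> x"
proof -
  have "(S +>\<^bsub>euclid\<^esub> x) <+>\<^bsub>euclid\<^esub> T = {s + x + t | s t. s \<in> S \<and> t \<in> T}"
    by (auto simp: set_add_def' a_r_coset_def')
  also have "\<dots> = {t + x | t. t \<in> T}"
  proof (intro equalityI subsetI)
    fix z assume "z \<in> {s + x + t | s t. s \<in> S \<and> t \<in> T}"
    then obtain s t where "s \<in> S" "t \<in> T" "z = (s + t) + x" by (auto simp: algebra_simps)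
    moreover have "s + t \<in> T" using subspace_add[OF T] calculation ST by auto
    ultimately show "z \<in> {t + x | t. t \<in> T}" by blast
  next
    fix z assume "z \<in> {t + x | t. t \<in> T}"
    then obtain t where "t \<in> T" "z = 0 + x + t" by (auto simp: algebra_simps)
    then show "z \<in> {s + x + t | s t. s \<in> S \<and> t \<in> T}" using subspace_0[OF S] by blast
  qed
  also have "\<dots> = T +>\<^bsub>euclid\<^esub> x" by (auto simp: a_r_coset_def')
  finally show ?thesis .
qed

section \<open>The cochain complex of a configuration\<close>

text \<open>Both cochain spaces of a configuration have this shape, so their linear algebra is done
  once.\<close>

definition coset_module :: "'i set \<Rightarrow> ('i \<Rightarrow> (real ^ 'n) set) \<Rightarrow> (real, 'i \<Rightarrow> (real ^ 'n) set) module" where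
  "coset_module I S = product_module I (\<lambda>i. quotient_module euclid (S i))"

text \<open>The quotient map on families of vectors: \<open>x\<close> is a lift of the resulting
  cochain, and its values off \<open>I\<close> are discarded.\<close>

definition coset_family :: "'i set \<Rightarrow> ('i \<Rightarrow> (real ^ 'n) set) \<Rightarrow> ('i \<Rightarrow> real ^ 'n) \<Rightarrow> 'i \<Rightarrow> (real ^ 'n) set" where
  "coset_family I S x = (\<lambda>i\<in>I. S i +>\<^bsub>euclid\<^esub> x i)"

text \<open>Coordinatewise from the laws for single cosets. The description of the carrier is what
  allows every cochain to be replaced by a lift.\<close>

lemma
  fixes S :: "'i \<Rightarrow> (real ^ 'n) set"
  assumes S: "\<And>i. i \<in> I \<Longrightarrow> real_vector.subspace (S i)"
  shows coset_family_add: "coset_family I S x \<oplus>\<^bsub>coset_module I S\<^esub> coset_family I S y = coset_family I S (\<lambda>i. x i + y i)"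
    and coset_family_smult: "c \<odot>\<^bsub>coset_module I S\<^esub> coset_family I S x = coset_family I S (\<lambda>i. c *\<^sub>R x i)"
    and coset_family_zero: "\<zero>\<^bsub>coset_module I S\<^esub> = coset_family I S (\<lambda>i. 0)"
    and carrier_coset_module: "carrier (coset_module I S) = range (coset_family I S)"
    and coset_family_eq_iff: "coset_family I S x = coset_family I S y \<longleftrightarrow> (\<forall>i\<in>I. x i - y i \<in> S i)"
    and vectorspace_coset_module: "vectorspace real_field (coset_module I S)"
proof -
  show "coset_family I S x \<oplus>\<^bsub>coset_module I S\<^esub> coset_family I S y = coset_family I S (\<lambda>i. x i + y i)"
    by (auto simp: coset_module_def coset_family_def product_module_def coset_add[OF S] intro!: restrict_ext)
  show "c \<odot>\<^bsub>coset_module I S\<^esub> coset_family I S x = coset_family I S (\<lambda>i. c *\<^sub>R x i)"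
    by (auto simp: coset_module_def coset_family_def product_module_def coset_smult[OF S] intro!: restrict_ext)
  show "\<zero>\<^bsub>coset_module I S\<^esub> = coset_family I S (\<lambda>i. 0)"
    by (auto simp: coset_module_def coset_family_def product_module_def coset_zero[OF S] intro!: restrict_ext)
  show "carrier (coset_module I S) = range (coset_family I S)"
  proof (intro equalityI subsetI)
    fix w assume "w \<in> carrier (coset_module I S)"
    then have w: "w \<in> (\<Pi>\<^sub>E i\<in>I. carrier (quotient_module euclid (S i)))"
      by (simp add: coset_module_def product_module_def)
    have "\<exists>x. w i = S i +>\<^bsub>euclid\<^esub> x" if "i \<in> I" for i
      using PiE_mem[OF w that] carrier_cosets[OF S[OF that]] by auto
    then obtain x where x: "\<And>i. i \<in> I \<Longrightarrow> w i = S i +>\<^bsub>euclid\<^esub> x i" by metis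
    have "w = coset_family I S x"
    proof
      fix i show "w i = coset_family I S x i"
        using x PiE_arb[OF w, of i] by (auto simp: coset_family_def)
    qed
    then show "w \<in> range (coset_family I S)" by blast
  next
    fix w assume "w \<in> range (coset_family I S)"
    then show "w \<in> carrier (coset_module I S)"
      using carrier_cosets[OF S]
      by (auto simp: coset_module_def product_module_def coset_family_def)
  qed
  show "coset_family I S x = coset_family I S y \<longleftrightarrow> (\<forall>i\<in>I. x i - y i \<in> S i)"
  proof -
    have "coset_family I S x = coset_family I S y \<longleftrightarrow>
      (\<forall>i\<in>I. S i +>\<^bsub>euclid\<^esub> x i = S i +>\<^bsub>euclid\<^esub> y i)"
      by (auto simp: coset_family_def restrict_def fun_eq_iff)
    then show ?thesis using coset_eq_iff[OF S] by simp
  qed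
  show "vectorspace real_field (coset_module I S)"
    unfolding coset_module_def
    by (intro vectorspace_product field_real_field vectorspace_quotient vectorspace_euclid subspace_euclid S)
qed

lemma
  fixes S :: "'i \<Rightarrow> (real ^ 'n) set"
  assumes "finite I" and S: "\<And>i. i \<in> I \<Longrightarrow> real_vector.subspace (S i)"
  shows fin_dim_coset_module: "vectorspace.fin_dim real_field (coset_module I S)"
    and dim_coset_module: "vectorspace.dim real_field (coset_module I S) = (\<Sum>i\<in>I. CARD('n) - real_vector.dim (S i))"
proof -
  let ?Q = "\<lambda>i. quotient_module euclid (S i)"
  have fd: "vectorspace.fin_dim real_field (?Q i)" if "i \<in> I" for i
    by (intro fin_dim_quotient fin_dim_euclid vectorspace_euclid subspace_euclid S that)
  have vs: "vectorspace real_field (?Q i)" if "i \<in> I" for i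
    by (intro vectorspace_quotient vectorspace_euclid subspace_euclid S that)
  show "vectorspace.fin_dim real_field (coset_module I S)"
    unfolding coset_module_def by (intro fin_dim_product field_real_field assms(1) vs fd)
  \<comment> \<open>The truncated subtraction is exact, because the dimensions of quotient and
    subspace add up to n.\<close>
  have "vectorspace.dim real_field (?Q i) = CARD('n) - real_vector.dim (S i)" if "i \<in> I" for i
    using dim_quotient[OF vectorspace_euclid subspace_euclid[OF S[OF that]] fin_dim_euclid]
    by (simp add: dim_euclid dim_euclid_subspace[OF S[OF that]])
  then show "vectorspace.dim real_field (coset_module I S) = (\<Sum>i\<in>I. CARD('n) - real_vector.dim (S i))"
    unfolding coset_module_def
    using dim_product[OF assms(1) field_real_field, of ?Q] vs fd by simp
qed

section \<open>Vertex and edge cochains of a configuration\<close>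

lemma
  assumes p: "p \<in> config_space \<Gamma> s"
  shows config_linear: "e \<in> edges \<Gamma> \<Longrightarrow> linear (snd p e)"
    and config_grassmannian: "v \<in> verts \<Gamma> \<Longrightarrow> fst p v \<in> grassmannian s"
    and config_subset_kernel: "e \<in> edges \<Gamma> \<Longrightarrow> v \<in> ends \<Gamma> e \<Longrightarrow> subspace_of (fst p v) \<subseteq> kernel_of (snd p e)"
  using p by (auto simp: config_space_def ambient_def kernel_of_def dest: PiE_mem)

definition vertex_subspaces :: "('v, 'e, 'n::finite) config \<Rightarrow> 'v \<Rightarrow> (real ^ 'n) set" where
  "vertex_subspaces p v = subspace_of (fst p v)"

definition edge_kernels :: "('v, 'e, 'n::finite) config \<Rightarrow> 'e \<Rightarrow> (real ^ 'n) set" where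
  "edge_kernels p e = kernel_of (snd p e)"

lemma subspace_vertex_subspaces: "real_vector.subspace (vertex_subspaces p v)"
  by (simp add: vertex_subspaces_def subspace_subspace_of)

lemma subspace_edge_kernels:
  "p \<in> config_space \<Gamma> s \<Longrightarrow> e \<in> edges \<Gamma> \<Longrightarrow> real_vector.subspace (edge_kernels p e)"
  by (simp add: edge_kernels_def subspace_kernel_of config_linear)

lemma cochains0_config: "cochains0 \<Gamma> (config_sheaf p) = coset_module (verts \<Gamma>) (vertex_subspaces p)"
  by (simp add: cochains0_def coset_module_def config_sheaf_def vertex_subspaces_def)

lemma cochains1_config: "cochains1 \<Gamma> (config_sheaf p) = coset_module (edges \<Gamma>) (edge_kernels p)"
  by (simp add: cochains1_def coset_module_def config_sheaf_def edge_kernels_def)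

text \<open>Because S_v lies in the kernel of \<alpha>_e, restriction keeps representatives; on
  lifts the coboundary is therefore a signed sum of vectors, read modulo the kernel.\<close>

lemma coboundary_coset_family:
  fixes p :: "('v, 'e, 'n::finite) config"
  assumes \<Gamma>: "finite_multigraph \<Gamma>" and p: "p \<in> config_space \<Gamma> s"
  shows "coboundary \<Gamma> \<sigma> (config_sheaf p) (coset_family (verts \<Gamma>) (vertex_subspaces p) x) =
    coset_family (edges \<Gamma>) (edge_kernels p) (\<lambda>e. \<Sum>v\<in>ends \<Gamma> e. \<sigma> v e *\<^sub>R x v)"
proof -
  have "finsum (quotient_module euclid (edge_kernels p e))
      (\<lambda>v. \<sigma> v e \<odot>\<^bsub>quotient_module euclid (edge_kernels p e)\<^esub>
        (coset_family (verts \<Gamma>) (vertex_subspaces p) x v <+>\<^bsub>euclid\<^esub> edge_kernels p e)) (ends \<Gamma> e)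
    = edge_kernels p e +>\<^bsub>euclid\<^esub> (\<Sum>v\<in>ends \<Gamma> e. \<sigma> v e *\<^sub>R x v)" (is "finsum ?Q ?f _ = _")
    if e: "e \<in> edges \<Gamma>" for e
  proof -
    note K = subspace_edge_kernels[OF p e]
    interpret Q: vectorspace real_field ?Q
      by (rule vectorspace_quotient[OF vectorspace_euclid subspace_euclid[OF K]])
    have fin: "finite (ends \<Gamma> e)" and sub: "ends \<Gamma> e \<subseteq> verts \<Gamma>"
      using \<Gamma> e by (auto simp: finite_multigraph_def intro: finite_subset)
    have f: "?f v = edge_kernels p e +>\<^bsub>euclid\<^esub> (\<sigma> v e *\<^sub>R x v)" if v: "v \<in> ends \<Gamma> e" for v
    proof -
      have "vertex_subspaces p v \<subseteq> edge_kernels p e"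
        using config_subset_kernel[OF p e v] by (simp add: vertex_subspaces_def edge_kernels_def)
      note coset_absorb[OF subspace_vertex_subspaces K this]
      then show ?thesis using v sub by (auto simp: coset_family_def coset_smult[OF K])
    qed
    have "finsum ?Q ?f (ends \<Gamma> e) =
        finsum ?Q (\<lambda>v. edge_kernels p e +>\<^bsub>euclid\<^esub> (\<sigma> v e *\<^sub>R x v)) (ends \<Gamma> e)"
      by (rule Q.M.finsum_cong'[OF refl _ f]) (auto simp: carrier_cosets[OF K])
    then show ?thesis by (simp add: coset_sum[OF K fin])
  qed
  then show ?thesis
    unfolding coboundary_def coset_family_def[of "edges \<Gamma>"]
    by (intro restrict_ext) (simp add: config_sheaf_def edge_kernels_def)
qed

lemma linear_map_coboundary:
  fixes p :: "('v, 'e, 'n::finite) config"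
  assumes \<Gamma>: "finite_multigraph \<Gamma>" and p: "p \<in> config_space \<Gamma> s"
  shows "linear_map real_field (cochains0 \<Gamma> (config_sheaf p)) (cochains1 \<Gamma> (config_sheaf p))
    (coboundary \<Gamma> \<sigma> (config_sheaf p))"
  unfolding cochains0_config cochains1_config
proof (rule linear_mapI)
  note S = subspace_vertex_subspaces and K = subspace_edge_kernels[OF p]
  let ?C0 = "coset_module (verts \<Gamma>) (vertex_subspaces p)"
  let ?d = "coboundary \<Gamma> \<sigma> (config_sheaf p)"
  show "vectorspace real_field ?C0" by (rule vectorspace_coset_module[OF S])
  show "vectorspace real_field (coset_module (edges \<Gamma>) (edge_kernels p))"
    by (rule vectorspace_coset_module[OF K])
  fix x assume "x \<in> carrier ?C0"
  then obtain x' where x: "x = coset_family (verts \<Gamma>) (vertex_subspaces p) x'"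
    by (auto simp: carrier_coset_module[OF S])
  show "?d x \<in> carrier (coset_module (edges \<Gamma>) (edge_kernels p))"
    unfolding x coboundary_coset_family[OF \<Gamma> p] by (simp add: carrier_coset_module[OF K])
  show "?d (c \<odot>\<^bsub>?C0\<^esub> x) = c \<odot>\<^bsub>coset_module (edges \<Gamma>) (edge_kernels p)\<^esub> ?d x" for c
    unfolding x coset_family_smult[OF S] coboundary_coset_family[OF \<Gamma> p]
    by (simp add: coset_family_smult[OF K] scaleR_sum_right mult.commute)
  fix y assume "y \<in> carrier ?C0"
  then obtain y' where y: "y = coset_family (verts \<Gamma>) (vertex_subspaces p) y'"
    by (auto simp: carrier_coset_module[OF S])
  show "?d (x \<oplus>\<^bsub>?C0\<^esub> y) = ?d x \<oplus>\<^bsub>coset_module (edges \<Gamma>) (edge_kernels p)\<^esub> ?d y"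
    unfolding x y coset_family_add[OF S] coboundary_coset_family[OF \<Gamma> p]
    by (simp add: coset_family_add[OF K] scaleR_add_right sum.distrib)
qed

section \<open>Rank-nullity for the coboundary\<close>

definition coboundary_image where
  "coboundary_image \<Gamma> \<sigma> p = cochains1 \<Gamma> (config_sheaf p)
     \<lparr>carrier := coboundary \<Gamma> \<sigma> (config_sheaf p) ` carrier (cochains0 \<Gamma> (config_sheaf p))\<rparr>"

definition coboundary_rank where
  "coboundary_rank \<Gamma> \<sigma> p = vectorspace.dim real_field (coboundary_image \<Gamma> \<sigma> p)"

lemma
  fixes p :: "('v, 'e, 'n::finite) config"
  assumes \<Gamma>: "finite_multigraph \<Gamma>" and p: "p \<in> config_space \<Gamma> s"
  shows vectorspace_coboundary_image: "vectorspace real_field (coboundary_image \<Gamma> \<sigma> p)"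
    and fin_dim_coboundary_image: "vectorspace.fin_dim real_field (coboundary_image \<Gamma> \<sigma> p)"
    and h0_plus_rank: "h0 \<Gamma> \<sigma> p + coboundary_rank \<Gamma> \<sigma> p = card (verts \<Gamma>) * (CARD('n) - s)"
    and h1_plus_rank: "p \<in> nonzero_covectors \<Gamma> \<Longrightarrow> h1 \<Gamma> \<sigma> p + coboundary_rank \<Gamma> \<sigma> p = card (edges \<Gamma>)"
proof -
  let ?C0 = "cochains0 \<Gamma> (config_sheaf p)" and ?C1 = "cochains1 \<Gamma> (config_sheaf p)"
  let ?d = "coboundary \<Gamma> \<sigma> (config_sheaf p)"
  let ?I = "coboundary_image \<Gamma> \<sigma> p"
  note S = subspace_vertex_subspaces and K = subspace_edge_kernels[OF p]
  have fin: "finite (verts \<Gamma>)" "finite (edges \<Gamma>)" using \<Gamma> by (auto simp: finite_multigraph_def)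
  interpret C0: vectorspace real_field ?C0 unfolding cochains0_config by (rule vectorspace_coset_module[OF S])
  interpret C1: vectorspace real_field ?C1 unfolding cochains1_config by (rule vectorspace_coset_module[OF K])
  interpret d: linear_map real_field ?C0 ?C1 ?d by (rule linear_map_coboundary[OF \<Gamma> p])
  have fd0: "C0.fin_dim" unfolding cochains0_config by (rule fin_dim_coset_module[OF fin(1) S])
  have fd1: "C1.fin_dim" unfolding cochains1_config by (rule fin_dim_coset_module[OF fin(2) K])
  have im: "d.im = ?d ` carrier ?C0" by (rule d.im_def)
  have sub: "VectorSpace.subspace real_field (?d ` carrier ?C0) ?C1"
    using d.imT_is_subspace unfolding im .
  show vs: "vectorspace real_field ?I"
    using C1.subspace_is_vs[OF sub] unfolding coboundary_image_def .
  \<comment> \<open>The coboundary corestricted to its image is onto, so the image inherits finite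
    dimension from the 0-cochains.\<close>
  have "linear_map real_field ?C0 ?I ?d"
    by (rule linear_mapI[OF C0.vectorspace_axioms vs]) (simp_all add: coboundary_image_def)
  then show "vectorspace.fin_dim real_field ?I"
    by (rule linear_map.surj_fin_dim[OF _ fd0]) (simp add: coboundary_image_def)
  have H0: "H0 \<Gamma> \<sigma> (config_sheaf p) = ?C0\<lparr>carrier := d.ker\<rparr>"
    unfolding H0_def a_kernel_def' d.ker_def by simp
  have "coboundary_rank \<Gamma> \<sigma> p + h0 \<Gamma> \<sigma> p = C0.dim"
    using d.rank_nullity[OF fd0] unfolding coboundary_rank_def h0_def H0 coboundary_image_def im .
  moreover have "C0.dim = card (verts \<Gamma>) * (CARD('n) - s)"
    unfolding cochains0_config dim_coset_module[OF fin(1) S]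
    by (simp add: vertex_subspaces_def dim_subspace_of[OF config_grassmannian[OF p]])
  ultimately show "h0 \<Gamma> \<sigma> p + coboundary_rank \<Gamma> \<sigma> p = card (verts \<Gamma>) * (CARD('n) - s)" by simp
  assume nz: "p \<in> nonzero_covectors \<Gamma>"
  have "C1.dim = (\<Sum>e\<in>edges \<Gamma>. CARD('n) - real_vector.dim (edge_kernels p e))"
    unfolding cochains1_config by (rule dim_coset_module[OF fin(2) K])
  also have "\<dots> = (\<Sum>e\<in>edges \<Gamma>. 1)"
  proof (rule sum.cong[OF refl])
    fix e assume e: "e \<in> edges \<Gamma>"
    have "snd p e \<noteq> (\<lambda>x. 0)" using nz e by (simp add: nonzero_covectors_def)
    \<comment> \<open>A hyperplane has dimension n - 1, and n is at least 1 because the index type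
      is nonempty; so each edge contributes exactly 1.\<close>
    from dim_kernel_of[OF config_linear[OF p e] this]
    show "CARD('n) - real_vector.dim (edge_kernels p e) = 1" by (simp add: edge_kernels_def Suc_leI)
  qed
  finally have "C1.dim = card (edges \<Gamma>)" by simp
  then show "h1 \<Gamma> \<sigma> p + coboundary_rank \<Gamma> \<sigma> p = card (edges \<Gamma>)"
    using dim_quotient[OF C1.vectorspace_axioms sub fd1]
    by (simp add: h1_def H1_def coboundary_rank_def coboundary_image_def)
qed

section \<open>Gram determinants\<close>

text \<open>Independence of an indexed family, so that a repeated member counts as a dependence;
  only the values on \<open>E\<close> enter.\<close>

definition lin_indep_on :: "'e set \<Rightarrow> nat \<Rightarrow> (nat \<Rightarrow> 'e \<Rightarrow> real) \<Rightarrow> bool" where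
  "lin_indep_on E k v \<longleftrightarrow> (\<forall>c. (\<forall>e\<in>E. (\<Sum>i<k. c i * v i e) = 0) \<longrightarrow> (\<forall>i<k. c i = 0))"

definition dot_on :: "'e set \<Rightarrow> ('e \<Rightarrow> real) \<Rightarrow> ('e \<Rightarrow> real) \<Rightarrow> real" where
  "dot_on E f g = (\<Sum>e\<in>E. f e * g e)"

text \<open>Up to factors that are powers of the pivots \<open>\<parallel>v\<^sub>0\<parallel>\<^sup>2\<close>, this is the Gram determinant: each step is a
  Gram--Schmidt step with denominators cleared, so that only polynomial operations occur.\<close>

primrec gram :: "'e set \<Rightarrow> nat \<Rightarrow> (nat \<Rightarrow> 'e \<Rightarrow> real) \<Rightarrow> real" where
  "gram E 0 v = 1"
| "gram E (Suc k) v = dot_on E (v 0) (v 0) *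
     gram E k (\<lambda>i e. dot_on E (v 0) (v 0) * v (Suc i) e - dot_on E (v 0) (v (Suc i)) * v 0 e)"

text \<open>A sum of real squares vanishes only termwise. This positivity is why a zero pivot
  signals a zero vector.\<close>

lemma dot_on_self_eq_0_iff: "finite E \<Longrightarrow> dot_on E f f = 0 \<longleftrightarrow> (\<forall>e\<in>E. f e = 0)"
  using sum_nonneg_eq_0_iff[of E "\<lambda>e. f e * f e"] by (simp add: dot_on_def)

text \<open>Induction on \<open>k\<close> over all families. With N = <v_0, v_0> and a_i = <v_0,
  v_(i+1)>, the family is independent iff N is nonzero and the vectors u_i = N v_(i+1) - a_i v_0 are
  independent, which matches the recursion of \<open>gram\<close>. For nonzero N, u_i is N times the
  component of v_(i+1) orthogonal to v_0.\<close>

lemma gram_nonzero_iff_lin_indep_on: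
  assumes E: "finite E"
  shows "gram E k v \<noteq> 0 \<longleftrightarrow> lin_indep_on E k v"
proof (induction k arbitrary: v)
  case 0
  show ?case by (simp add: lin_indep_on_def)
next
  case (Suc k)
  let ?N = "dot_on E (v 0) (v 0)"
  let ?a = "\<lambda>i. dot_on E (v 0) (v (Suc i))"
  let ?u = "\<lambda>i e. ?N * v (Suc i) e - ?a i * v 0 e"
  have split: "(\<Sum>i<Suc k. c i * v i e) = c 0 * v 0 e + (\<Sum>i<k. c (Suc i) * v (Suc i) e)" for c e
    by (rule sum.lessThan_Suc_shift)
  have u: "(\<Sum>i<k. c i * ?u i e) = ?N * (\<Sum>i<k. c i * v (Suc i) e) - (\<Sum>i<k. c i * ?a i) * v 0 e" for c e
    by (simp add: sum_distrib_left sum_distrib_right sum_subtractf[symmetric] algebra_simps)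
  have "lin_indep_on E (Suc k) v \<longleftrightarrow> ?N \<noteq> 0 \<and> lin_indep_on E k ?u"
  proof (intro iffI conjI)
    assume li: "lin_indep_on E (Suc k) v"
    show N: "?N \<noteq> 0"
    proof
      \<comment> \<open>Then v_0 vanishes on \<open>E\<close>, and the coefficients (1, 0, ..., 0)
        form a nontrivial relation.\<close>
      assume "?N = 0"
      then have "\<forall>e\<in>E. (\<Sum>i<Suc k. (if i = 0 then 1 else 0) * v i e) = 0"
        unfolding split using dot_on_self_eq_0_iff[OF E] by simp
      then show False
        using li[unfolded lin_indep_on_def, rule_format, of "\<lambda>i. if i = 0 then 1 else 0" 0] by auto
    qed
    show "lin_indep_on E k ?u"
      unfolding lin_indep_on_def
    proof (intro allI impI)
      fix c i assume c: "\<forall>e\<in>E. (\<Sum>i<k. c i * ?u i e) = 0" and i: "i < k"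
      \<comment> \<open>Expanding the u_i turns a relation among them into one among the v_i, with
        coefficient N c_j at v_(j+1) and minus the sum of the c_i a_i at v_0.\<close>
      define c' where "c' = (\<lambda>i. case i of 0 \<Rightarrow> - (\<Sum>i<k. c i * ?a i) | Suc j \<Rightarrow> ?N * c j)"
      have "\<forall>e\<in>E. (\<Sum>i<Suc k. c' i * v i e) = 0"
        using c unfolding split u by (simp add: c'_def sum_distrib_left mult.assoc)
      then have "c' (Suc i) = 0" using li i unfolding lin_indep_on_def by blast
      then show "c i = 0" using N by (simp add: c'_def)
    qed
  next
    assume "?N \<noteq> 0 \<and> lin_indep_on E k ?u"
    then have N: "?N \<noteq> 0" and li: "lin_indep_on E k ?u" by auto
    show "lin_indep_on E (Suc k) v"
      unfolding lin_indep_on_def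
    proof (rule allI, rule impI)
      fix c assume c: "\<forall>e\<in>E. (\<Sum>i<Suc k. c i * v i e) = 0"
      \<comment> \<open>Pairing the relation with v_0 shows that the sum of the c_(i+1) a_i is -c_0
        N. The shifted coefficients then combine the u_i to N times the given relation, so they
        vanish, and c_0 = 0 follows since N is nonzero.\<close>
      have "0 = (\<Sum>e\<in>E. v 0 e * (\<Sum>i<Suc k. c i * v i e))" using c by simp
      also have "\<dots> = (\<Sum>i<Suc k. c i * dot_on E (v 0) (v i))"
        unfolding dot_on_def sum_distrib_left by (subst sum.swap) (simp add: algebra_simps)
      also have "\<dots> = c 0 * ?N + (\<Sum>i<k. c (Suc i) * ?a i)"
        by (rule sum.lessThan_Suc_shift)
      finally have a: "(\<Sum>i<k. c (Suc i) * ?a i) = - (c 0 * ?N)" by simp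
      have "(\<Sum>i<k. c (Suc i) * ?u i e) = 0" if "e \<in> E" for e
      proof -
        have "(\<Sum>i<k. c (Suc i) * ?u i e) = ?N * (\<Sum>i<Suc k. c i * v i e)"
          unfolding split u a by (simp add: algebra_simps)
        then show ?thesis using c that by simp
      qed
      then have c0: "\<forall>i<k. c (Suc i) = 0" using li[unfolded lin_indep_on_def, rule_format, of "\<lambda>i. c (Suc i)"] by blast
      then have "c 0 = 0" using a N by simp
      then show "\<forall>i<Suc k. c i = 0" using c0 by (auto simp: less_Suc_eq_0_disj)
    qed
  qed
  then show ?case using Suc.IH[of ?u] by simp
qed

section \<open>Gram determinants as regular functions\<close>

lemma regular_function_sum:
  "finite A \<Longrightarrow> (\<And>a. a \<in> A \<Longrightarrow> regular_function \<Gamma> (f a)) \<Longrightarrow> regular_function \<Gamma> (\<lambda>p. \<Sum>a\<in>A. f a p)"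
  by (induction A rule: finite_induct) (simp_all add: regular_function.const regular_function.add)

lemma regular_function_diff:
  assumes "regular_function \<Gamma> f" "regular_function \<Gamma> g"
  shows "regular_function \<Gamma> (\<lambda>p. f p - g p)"
  using regular_function.add[OF assms(1) regular_function.mult[OF regular_function.const[of _ "-1"] assms(2)]]
  by simp

text \<open>With denominators cleared, each step uses only sums, differences and products. The
  induction generalises \<open>v\<close> because the recursive call receives the modified family,
  whose entries are again regular.\<close>

lemma regular_function_gram:
  assumes E: "finite E" and "\<And>i e. e \<in> E \<Longrightarrow> regular_function \<Gamma> (\<lambda>p. v p i e)"
  shows "regular_function \<Gamma> (\<lambda>p. gram E k (v p))"
  using assms(2)
proof (induction k arbitrary: v)
  case 0
  show ?case by (simp add: regular_function.const)
next
  case (Suc k)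
  have dot: "regular_function \<Gamma> (\<lambda>p. dot_on E (v p i) (v p j))" for i j
    unfolding dot_on_def by (intro regular_function_sum[OF E] regular_function.mult Suc.prems)
  show ?case
    unfolding gram.simps
    by (intro regular_function.mult dot Suc.IH regular_function_diff Suc.prems)
qed

text \<open>\<open>\<Phi>\<close> acts as an injective linear map from \<open>U\<close> to functions
  on \<open>E\<close>, so independence in \<open>U\<close> can be tested on images.\<close>

lemma dim_ge_iff_lin_indep_on:
  assumes U: "vectorspace real_field U" and fd: "vectorspace.fin_dim real_field U"
    and add: "\<And>x y e. x \<in> carrier U \<Longrightarrow> y \<in> carrier U \<Longrightarrow> e \<in> E \<Longrightarrow> \<Phi> (x \<oplus>\<^bsub>U\<^esub> y) e = \<Phi> x e + \<Phi> y e"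
    and smult: "\<And>c x e. x \<in> carrier U \<Longrightarrow> e \<in> E \<Longrightarrow> \<Phi> (c \<odot>\<^bsub>U\<^esub> x) e = c * \<Phi> x e"
    and inj: "\<And>x. x \<in> carrier U \<Longrightarrow> \<forall>e\<in>E. \<Phi> x e = 0 \<Longrightarrow> x = \<zero>\<^bsub>U\<^esub>"
  shows "k \<le> vectorspace.dim real_field U \<longleftrightarrow>
    (\<exists>y. (\<forall>i. y i \<in> carrier U) \<and> lin_indep_on E k (\<lambda>i. \<Phi> (y i)))"
proof -
  interpret U: vectorspace real_field U by fact
  have zero: "\<Phi> \<zero>\<^bsub>U\<^esub> e = 0" if "e \<in> E" for e
    using smult[of "\<zero>\<^bsub>U\<^esub>" e 0] that by simp
  have lincomb: "\<Phi> (U.lincomb a A) e = (\<Sum>x\<in>A. a x * \<Phi> x e)"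
    if "finite A" "A \<subseteq> carrier U" "e \<in> E" for a A e
    using that
  proof (induction A)
    case (insert x A)
    have f: "(\<lambda>v. a v \<odot>\<^bsub>U\<^esub> v) \<in> A \<rightarrow> carrier U" "a x \<odot>\<^bsub>U\<^esub> x \<in> carrier U"
      using insert.prems by auto
    then have "finsum U (\<lambda>v. a v \<odot>\<^bsub>U\<^esub> v) A \<in> carrier U" by simp
    then show ?case using insert f by (simp add: U.lincomb_def add smult)
  qed (simp add: U.lincomb_def zero)
  have lc0: "U.lincomb a A = \<zero>\<^bsub>U\<^esub> \<longleftrightarrow> (\<forall>e\<in>E. (\<Sum>x\<in>A. a x * \<Phi> x e) = 0)"
    if "finite A" "A \<subseteq> carrier U" for a A
  proof
    assume "U.lincomb a A = \<zero>\<^bsub>U\<^esub>"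
    then show "\<forall>e\<in>E. (\<Sum>x\<in>A. a x * \<Phi> x e) = 0" using lincomb[OF that, of _ a] zero by simp
  next
    assume "\<forall>e\<in>E. (\<Sum>x\<in>A. a x * \<Phi> x e) = 0"
    then show "U.lincomb a A = \<zero>\<^bsub>U\<^esub>" using inj[of "U.lincomb a A"] lincomb[OF that, of _ a] that by simp
  qed
  show ?thesis
  proof
    assume k: "k \<le> U.dim"
    obtain B where B: "finite B" "U.basis B" using U.finite_basis_exists[OF fd] by blast
    then have BU: "B \<subseteq> carrier U" and li: "U.lin_indpt B" and "card B = U.dim"
      using U.dim_basis[OF B] by (auto simp: U.basis_def)
    then obtain A where A: "A \<subseteq> B" "card A = k" "finite A"
      using obtain_subset_with_card_n[of k B] k by metis
    then obtain h where h: "bij_betw h {..<k} A"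
      using ex_bij_betw_nat_finite[of A] by (auto simp: atLeast0LessThan)
    \<comment> \<open>The family is indexed by all naturals; from \<open>k\<close> on it is zero,
      only to stay in the carrier.\<close>
    define y where "y = (\<lambda>i. if i < k then h i else \<zero>\<^bsub>U\<^esub>)"
    have "\<forall>i. y i \<in> carrier U" using h A(1) BU by (auto simp: y_def bij_betw_def)
    moreover have "lin_indep_on E k (\<lambda>i. \<Phi> (y i))"
      unfolding lin_indep_on_def
    proof (intro allI impI)
      fix c i assume c: "\<forall>e\<in>E. (\<Sum>i<k. c i * \<Phi> (y i) e) = 0" and i: "i < k"
      \<comment> \<open>Coefficients indexed by position become coefficients indexed by vector,
        through the inverse of the enumeration \<open>h\<close>.\<close>
      define a where "a = (\<lambda>x. c (inv_into {..<k} h x))"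
      have ah: "a (h j) = c j" if "j < k" for j
        using that bij_betw_inv_into_left[OF h, of j] by (simp add: a_def)
      have "(\<Sum>x\<in>A. a x * \<Phi> x e) = (\<Sum>i<k. c i * \<Phi> (y i) e)" for e
        unfolding sum.reindex_bij_betw[OF h, symmetric] by (rule sum.cong) (auto simp: ah y_def)
      then have "U.lincomb a A = \<zero>\<^bsub>U\<^esub>" using lc0[OF A(3)] A(1) BU c by auto
      moreover have "h i \<in> A" using h i by (auto simp: bij_betw_def)
      ultimately have "a (h i) = 0"
        using U.lin_dep_crit[OF A(3,1), of a "h i"] li by auto
      then show "c i = 0" using ah i by simp
    qed
    ultimately show "\<exists>y. (\<forall>i. y i \<in> carrier U) \<and> lin_indep_on E k (\<lambda>i. \<Phi> (y i))" by blast
  next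
    assume "\<exists>y. (\<forall>i. y i \<in> carrier U) \<and> lin_indep_on E k (\<lambda>i. \<Phi> (y i))"
    then obtain y where y: "\<And>i. y i \<in> carrier U" and li: "lin_indep_on E k (\<lambda>i. \<Phi> (y i))" by blast
    have inj: "inj_on y {..<k}"
    proof (rule inj_onI, rule ccontr)
      fix i j assume ij: "i \<in> {..<k}" "j \<in> {..<k}" "y i = y j" "i \<noteq> j"
      \<comment> \<open>If two positions carried the same vector, coefficients 1 and -1 there would
        form a nontrivial relation. Hence the family has \<open>k\<close> distinct members.\<close>
      let ?c = "\<lambda>l. (if l = i then 1 else 0) - (if l = j then 1 else 0) :: real"
      have "(\<Sum>l<k. ?c l * \<Phi> (y l) e) = 0" for e
      proof -
        have "?c l * \<Phi> (y l) e = (if l = i then \<Phi> (y i) e else 0) - (if l = j then \<Phi> (y i) e else 0)" for l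
          using ij(3) by auto
        then show ?thesis using ij(1,2) by (simp add: sum_subtractf)
      qed
      then have "?c i = 0" using li[unfolded lin_indep_on_def, rule_format, of ?c i] ij(1) by simp
      then show False using ij(4) by simp
    qed
    have "U.lin_indpt (y ` {..<k})"
    proof (rule U.finite_lin_indpt2)
      fix a assume "U.lincomb a (y ` {..<k}) = \<zero>\<^bsub>U\<^esub>"
      then have "\<forall>e\<in>E. (\<Sum>i<k. a (y i) * \<Phi> (y i) e) = 0"
        using lc0[of "y ` {..<k}" a] y by (auto simp: sum.reindex[OF inj])
      then have "\<forall>i<k. a (y i) = 0"
        using li[unfolded lin_indep_on_def, rule_format, of "\<lambda>i. a (y i)"] by blast
      then show "\<forall>v\<in>y ` {..<k}. a v = \<zero>\<^bsub>real_field\<^esub>" by simp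
    qed (use y in auto)
    then have "card (y ` {..<k}) \<le> U.dim"
      using U.li_le_dim(2)[OF fd] y by blast
    then show "k \<le> U.dim" by (simp add: card_image[OF inj])
  qed
qed

section \<open>Semicontinuity\<close>

text \<open>Written through the values of the covectors on the standard basis, which are among the
  generators of \<open>regular_function\<close>.\<close>

definition lifted_coboundary ::
  "('v, 'e) multigraph \<Rightarrow> ('v \<Rightarrow> 'e \<Rightarrow> real) \<Rightarrow> ('v, 'e, 'n::finite) config \<Rightarrow> ('v \<Rightarrow> real ^ 'n) \<Rightarrow> 'e \<Rightarrow> real"
where
  "lifted_coboundary \<Gamma> \<sigma> p w e = (\<Sum>v\<in>ends \<Gamma> e. \<sigma> v e * (\<Sum>i\<in>UNIV. w v $ i * snd p e (axis i 1)))"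

lemma lifted_coboundary_eq:
  assumes "linear (snd p e)"
  shows "lifted_coboundary \<Gamma> \<sigma> p w e = snd p e (\<Sum>v\<in>ends \<Gamma> e. \<sigma> v e *\<^sub>R w v)"
proof -
  interpret linear "snd p e" by fact
  have expand: "snd p e u = (\<Sum>i\<in>UNIV. u $ i * snd p e (axis i 1))" for u
  proof -
    have "snd p e u = snd p e (\<Sum>i\<in>UNIV. (u $ i) *\<^sub>R axis i 1)"
      using basis_expansion[of u] by (simp add: scalar_mult_eq_scaleR)
    then show ?thesis by (simp add: sum scale)
  qed
  show ?thesis by (simp add: lifted_coboundary_def sum scale expand[symmetric])
qed

text \<open>With \<open>w\<close> held fixed, this is a linear form in the covector coordinates with
  constant coefficients.\<close>

lemma regular_function_lifted_coboundary:
  assumes "finite_multigraph \<Gamma>" "e \<in> edges \<Gamma>"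
  shows "regular_function \<Gamma> (\<lambda>p :: ('v, 'e, 'n::finite) config. lifted_coboundary \<Gamma> \<sigma> p w e)"
proof -
  have "finite (ends \<Gamma> e)" using assms by (auto simp: finite_multigraph_def intro: finite_subset)
  then show ?thesis
    unfolding lifted_coboundary_def
    by (intro regular_function_sum regular_function.mult regular_function.const
        regular_function.covector_entry assms(2)) auto
qed

text \<open>Coboundaries embed into functions on the edges by applying \<alpha>_e to a
  representative at \<open>e\<close>, so the dimension criterion applies to the image. Choosing
  lifts of 0-cochains expresses it through \<open>lifted_coboundary\<close>.\<close>

lemma coboundary_rank_ge_iff:
  fixes p :: "('v, 'e, 'n::finite) config"
  assumes \<Gamma>: "finite_multigraph \<Gamma>" and p: "p \<in> config_space \<Gamma> s"
  shows "k \<le> coboundary_rank \<Gamma> \<sigma> p \<longleftrightarrow> (\<exists>w. gram (edges \<Gamma>) k (\<lambda>i. lifted_coboundary \<Gamma> \<sigma> p (w i)) \<noteq> 0)"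
proof -
  let ?E = "edges \<Gamma>"
  let ?K = "edge_kernels p"
  let ?I = "coboundary_image \<Gamma> \<sigma> p"
  note S = subspace_vertex_subspaces and K = subspace_edge_kernels[OF p]
  have E: "finite ?E" using \<Gamma> by (simp add: finite_multigraph_def)
  \<comment> \<open>The chosen representative is immaterial, since \<alpha>_e vanishes on
    differences within a coset of its kernel.\<close>
  define \<Phi> where "\<Phi> y e = snd p e (SOME x. y e = ?K e +>\<^bsub>euclid\<^esub> x)" for y e
  \<comment> \<open>\<open>im w\<close> is the coboundary of the 0-cochain with lift
    \<open>w\<close>.\<close>
  define im where "im w = coset_family ?E ?K (\<lambda>e. \<Sum>v\<in>ends \<Gamma> e. \<sigma> v e *\<^sub>R w v)" for w
  have \<Phi>: "\<Phi> (coset_family ?E ?K x) e = snd p e (x e)" if e: "e \<in> ?E" for x e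
  proof -
    let ?z = "SOME z. ?K e +>\<^bsub>euclid\<^esub> x e = ?K e +>\<^bsub>euclid\<^esub> z"
    have "?K e +>\<^bsub>euclid\<^esub> x e = ?K e +>\<^bsub>euclid\<^esub> ?z" by (rule someI[of _ "x e"]) simp
    then have "x e - ?z \<in> ?K e" using coset_eq_iff[OF K[OF e]] by blast
    then have "snd p e (x e) = snd p e ?z"
      using linear_diff[OF config_linear[OF p e], of "x e" ?z] by (simp add: edge_kernels_def kernel_of_def)
    then show ?thesis using e by (simp add: \<Phi>_def coset_family_def)
  qed
  have carr: "carrier ?I = range im"
    unfolding coboundary_image_def cochains0_config carrier_coset_module[OF S]
    by (simp add: image_image coboundary_coset_family[OF \<Gamma> p] im_def)
  have ops: "x \<oplus>\<^bsub>?I\<^esub> y = x \<oplus>\<^bsub>coset_module ?E ?K\<^esub> y" "c \<odot>\<^bsub>?I\<^esub> x = c \<odot>\<^bsub>coset_module ?E ?K\<^esub> x"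
    "\<zero>\<^bsub>?I\<^esub> = \<zero>\<^bsub>coset_module ?E ?K\<^esub>" for x y c
    by (simp_all add: coboundary_image_def cochains1_config)
  have "k \<le> coboundary_rank \<Gamma> \<sigma> p \<longleftrightarrow>
    (\<exists>y. (\<forall>i. y i \<in> carrier ?I) \<and> lin_indep_on ?E k (\<lambda>i. \<Phi> (y i)))"
    unfolding coboundary_rank_def
  proof (rule dim_ge_iff_lin_indep_on)
    show "vectorspace real_field ?I" "vectorspace.fin_dim real_field ?I"
      by (rule vectorspace_coboundary_image[OF \<Gamma> p] fin_dim_coboundary_image[OF \<Gamma> p])+
    show "\<Phi> (x \<oplus>\<^bsub>?I\<^esub> y) e = \<Phi> x e + \<Phi> y e"
      if xy: "x \<in> carrier ?I" "y \<in> carrier ?I" and e: "e \<in> ?E" for x y e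
    proof -
      obtain x' y' where "x = coset_family ?E ?K x'" "y = coset_family ?E ?K y'"
        using xy by (auto simp: carr im_def)
      then show ?thesis
        by (simp add: ops coset_family_add[OF K] \<Phi>[OF e] linear_add[OF config_linear[OF p e]])
    qed
    show "\<Phi> (c \<odot>\<^bsub>?I\<^esub> x) e = c * \<Phi> x e" if x: "x \<in> carrier ?I" and e: "e \<in> ?E" for c x e
    proof -
      obtain x' where "x = coset_family ?E ?K x'" using x by (auto simp: carr im_def)
      then show ?thesis
        by (simp add: ops coset_family_smult[OF K] \<Phi>[OF e] linear_scale[OF config_linear[OF p e]])
    qed
    \<comment> \<open>If each \<alpha>_e vanishes on the representative at \<open>e\<close>, every
      representative lies in its kernel, so the family of cosets is zero.\<close>
    show "x = \<zero>\<^bsub>?I\<^esub>" if x: "x \<in> carrier ?I" and 0: "\<forall>e\<in>?E. \<Phi> x e = 0" for x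
    proof -
      obtain x' where "x = coset_family ?E ?K x'" using x by (auto simp: carr im_def)
      then show ?thesis
        using 0 coset_family_eq_iff[OF K, where x = x' and y = "\<lambda>i. 0"]
        by (simp add: ops coset_family_zero[OF K] \<Phi>) (simp add: edge_kernels_def kernel_of_def)
    qed
  qed
  also have "\<dots> \<longleftrightarrow> (\<exists>w. lin_indep_on ?E k (\<lambda>i. \<Phi> (im (w i))))"
  proof
    assume "\<exists>y. (\<forall>i. y i \<in> carrier ?I) \<and> lin_indep_on ?E k (\<lambda>i. \<Phi> (y i))"
    then obtain y where y: "\<forall>i. y i \<in> range im" and li: "lin_indep_on ?E k (\<lambda>i. \<Phi> (y i))"
      unfolding carr by blast
    have "\<forall>i. \<exists>w. y i = im w" using y by blast
    from choice[OF this] obtain w where "\<forall>i. y i = im (w i)" ..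
    then have "y = (\<lambda>i. im (w i))" by (intro ext) simp
    then show "\<exists>w. lin_indep_on ?E k (\<lambda>i. \<Phi> (im (w i)))" using li by blast
  next
    assume "\<exists>w. lin_indep_on ?E k (\<lambda>i. \<Phi> (im (w i)))"
    then obtain w where "lin_indep_on ?E k (\<lambda>i. \<Phi> (im (w i)))" ..
    then show "\<exists>y. (\<forall>i. y i \<in> carrier ?I) \<and> lin_indep_on ?E k (\<lambda>i. \<Phi> (y i))"
      unfolding carr by (intro exI[of _ "\<lambda>i. im (w i)"] conjI allI rangeI)
  qed
  also have "\<dots> \<longleftrightarrow> (\<exists>w. lin_indep_on ?E k (\<lambda>i. lifted_coboundary \<Gamma> \<sigma> p (w i)))"
  proof -
    have "\<Phi> (im w) e = lifted_coboundary \<Gamma> \<sigma> p w e" if "e \<in> ?E" for w e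
      using that by (simp add: im_def \<Phi> lifted_coboundary_eq config_linear[OF p])
    then show ?thesis by (simp add: lin_indep_on_def)
  qed
  finally show ?thesis by (simp add: gram_nonzero_iff_lin_indep_on[OF E])
qed

text \<open>The set is the intersection of \<open>Y\<close> with the locus where some Gram
  determinant is nonzero. A general \<open>Y\<close> serves both the whole configuration space and
  its part with nonzero covectors.\<close>

lemma openin_coboundary_rank_ge:
  assumes \<Gamma>: "finite_multigraph \<Gamma>" and Y: "Y \<subseteq> config_space \<Gamma> s"
  defines "X \<equiv> subtopology (zariski_topology \<Gamma> s) Y :: ('v, 'e, 'n::finite) config topology"
  shows "openin X {p \<in> topspace X. k \<le> coboundary_rank \<Gamma> \<sigma> p}"
proof -
  define G where "G w p = gram (edges \<Gamma>) k (\<lambda>i. lifted_coboundary \<Gamma> \<sigma> p (w i))"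
    for w and p :: "('v, 'e, 'n) config"
  \<comment> \<open>Openness is shown in the whole ambient variety: the complement is the common
    zero set of the possibly infinite family \<open>range G\<close>. The link with the rank is made
    at points of \<open>Y\<close>.\<close>
  define U where "U = {p \<in> ambient \<Gamma> s. \<exists>w. G w p \<noteq> 0}"
  have "finite (edges \<Gamma>)" using \<Gamma> by (simp add: finite_multigraph_def)
  then have "range G \<subseteq> Collect (regular_function \<Gamma>)"
    unfolding G_def
    by (auto intro!: regular_function_gram regular_function_lifted_coboundary[OF \<Gamma>])
  moreover have "ambient \<Gamma> s - U = {p \<in> ambient \<Gamma> s. \<forall>f\<in>range G. f p = 0}"
    by (auto simp: U_def)
  ultimately have "zariski_closed \<Gamma> s (ambient \<Gamma> s - U)"
    unfolding zariski_closed_def by blast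
  then have U: "openin (zariski_topology \<Gamma> s) U"
    by (auto simp: openin_zariski_topology U_def)
  have "{p \<in> topspace X. k \<le> coboundary_rank \<Gamma> \<sigma> p} = U \<inter> Y"
  proof -
    have "p \<in> U \<longleftrightarrow> k \<le> coboundary_rank \<Gamma> \<sigma> p" if "p \<in> Y" for p
    proof -
      have p: "p \<in> config_space \<Gamma> s" using that Y by auto
      then have "p \<in> ambient \<Gamma> s" by (auto simp: config_space_def)
      then show ?thesis using coboundary_rank_ge_iff[OF \<Gamma> p, of k \<sigma>] by (simp add: U_def G_def)
    qed
    then show ?thesis using openin_subset[OF U] by (auto simp: X_def)
  qed
  then show ?thesis using U by (auto simp: X_def openin_subtopology)
qed

text \<open>As f = N - r, the set where r is at least \<open>r x\<close> is an open neighbourhood of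
  \<open>x\<close> on which f is at most \<open>f x\<close>. So a sublevel set contains a
  neighbourhood of each of its points.\<close>

lemma upper_semicontinuous_of_corank:
  assumes "\<And>x. x \<in> topspace X \<Longrightarrow> f x + r x = N"
    and "\<And>k. openin X {x \<in> topspace X. k \<le> r x}"
  shows "upper_semicontinuous X f"
  unfolding upper_semicontinuous_def
proof (intro allI, subst openin_subopen, intro ballI)
  fix a :: real and x assume x: "x \<in> {x \<in> topspace X. real (f x) < a}"
  have "{y \<in> topspace X. r x \<le> r y} \<subseteq> {x \<in> topspace X. real (f x) < a}"
  proof
    fix y assume y: "y \<in> {y \<in> topspace X. r x \<le> r y}"
    have "f y \<le> f x" using assms(1)[of x] assms(1)[of y] x y by simp
    then show "y \<in> {x \<in> topspace X. real (f x) < a}" using x y by auto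
  qed
  then show "\<exists>T. openin X T \<and> x \<in> T \<and> T \<subseteq> {x \<in> topspace X. real (f x) < a}"
    using assms(2)[of "r x"] x by (intro exI[of _ "{y \<in> topspace X. r x \<le> r y}"]) auto
qed

theorem mainTheorem11:
  fixes \<Gamma> :: "('v, 'e) multigraph" and \<sigma> :: "'v \<Rightarrow> 'e \<Rightarrow> real" and s :: nat
  assumes "finite_multigraph \<Gamma>" and "signed_incidence \<Gamma> \<sigma>"
    and "s > 0" and "2 * s \<le> CARD('n::finite)"
  shows "upper_semicontinuous (config_topology \<Gamma> s :: ('v, 'e, 'n) config topology) (h0 \<Gamma> \<sigma>) \<and>
    upper_semicontinuous
      (subtopology (config_topology \<Gamma> s :: ('v, 'e, 'n) config topology) (nonzero_covectors \<Gamma>))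
      (h1 \<Gamma> \<sigma>)"
proof
  let ?Z = "zariski_topology \<Gamma> s :: ('v, 'e, 'n) config topology"
  show "upper_semicontinuous (config_topology \<Gamma> s :: ('v, 'e, 'n) config topology) (h0 \<Gamma> \<sigma>)"
    unfolding config_topology_def
  proof (rule upper_semicontinuous_of_corank[where r = "coboundary_rank \<Gamma> \<sigma>"])
    show "openin (subtopology ?Z (config_space \<Gamma> s))
        {p \<in> topspace (subtopology ?Z (config_space \<Gamma> s)). k \<le> coboundary_rank \<Gamma> \<sigma> p}" for k
      by (rule openin_coboundary_rank_ge[OF assms(1) order_refl])
  qed (auto intro: h0_plus_rank[OF assms(1)])
  \<comment> \<open>Restricting twice is restricting to the intersection, so the openness result
    applies with \<open>Y\<close> the configurations without zero covectors. There the space of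
    1-cochains has constant dimension, the number of edges.\<close>
  show "upper_semicontinuous
      (subtopology (config_topology \<Gamma> s :: ('v, 'e, 'n) config topology) (nonzero_covectors \<Gamma>))
      (h1 \<Gamma> \<sigma>)"
    unfolding config_topology_def subtopology_subtopology
  proof (rule upper_semicontinuous_of_corank[where r = "coboundary_rank \<Gamma> \<sigma>"])
    let ?X = "subtopology ?Z (config_space \<Gamma> s \<inter> nonzero_covectors \<Gamma>)"
    show "openin ?X {p \<in> topspace ?X. k \<le> coboundary_rank \<Gamma> \<sigma> p}" for k
      by (rule openin_coboundary_rank_ge[OF assms(1)]) simp
  qed (auto intro: h1_plus_rank[OF assms(1)])
qed

end
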